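(* Let $H(s)$ be the Shannon entropy at time $s$ of the rate-1 simple random walk, or of the rate-1 directed random walk, on $\mathbb{Z}$. Then, for $s\gtrsim1$, $$H(s)=\tfrac12\log(2\pi e s)+O(s^{-1/4}).$$ That is, for every $\varsigma>0$ there is a constant $C=C(\varsigma)$ such that $\bigl|H(s)-\tfrac12\log(2\pi e s)\bigr|\le C s^{-1/4}$ for all $s\ge\varsigma$.
   Context: The rate-1 simple random walk on $\mathbb{Z}$ started at $0$ jumps at rate 1, each jump being $+1$ or $-1$ with probability $1/2$ each; the rate-1 directed random walk is the same but each jump is $+1$. If $X_s$ is the position at time $s$ and $\nu_s$ its law, then $H(s):=-\sum_{x\in\mathbb{Z}}\nu_s(x)\log\nu_s(x)$, with natural logarithm and $0\log0=0$. *)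

theory Defs
  imports "HOL-Probability.Probability"
begin

text \<open>
  Continuous-time random walks on the integers which start at 0 and jump at rate 1: \<open>\<tau> i\<close> is the
  holding time before the \<open>i\<close>-th jump (counting from 0) and \<open>\<xi> i\<close> is the increment of that jump.
\<close>

locale rate1_walk = prob_space M
  for M :: "'a measure" and step :: "int pmf"
    and \<tau> :: "nat \<Rightarrow> 'a \<Rightarrow> real" and \<xi> :: "nat \<Rightarrow> 'a \<Rightarrow> int" +
  assumes holding_time: "\<And>i. distributed M lborel (\<tau> i) (exponential_density 1)"
    and increment: "\<And>i. distr M (count_space UNIV) (\<xi> i) = measure_pmf step"
    and indep: "indep_vars (\<lambda>_. borel) (case_sum \<tau> (\<lambda>i \<omega>. real_of_int (\<xi> i \<omega>))) UNIV"
    \<comment> \<open>all \<open>\<tau> i\<close> and \<open>\<xi> j\<close> jointly independent: one family indexed by \<open>nat + nat\<close>\<close>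

definition simple_step :: "int pmf" where
  "simple_step = pmf_of_set {-1, 1}"

definition directed_step :: "int pmf" where
  "directed_step = return_pmf 1"

text \<open>
  The \<open>n\<close>-th jump happens at time \<open>\<tau> 0 + \<dots> + \<tau> n\<close>. Almost surely only finitely many jumps happen
  before any given time; otherwise \<^const>\<open>card\<close> of the infinite set is 0.
\<close>

definition jumps_until :: "(nat \<Rightarrow> 'a \<Rightarrow> real) \<Rightarrow> real \<Rightarrow> 'a \<Rightarrow> nat" where
  "jumps_until \<tau> s \<omega> = card {n. (\<Sum>i\<le>n. \<tau> i \<omega>) \<le> s}"

definition position :: "(nat \<Rightarrow> 'a \<Rightarrow> real) \<Rightarrow> (nat \<Rightarrow> 'a \<Rightarrow> int) \<Rightarrow> real \<Rightarrow> 'a \<Rightarrow> int" where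
  "position \<tau> \<xi> s \<omega> = (\<Sum>i<jumps_until \<tau> s \<omega>. \<xi> i \<omega>)"

definition walk_law :: "'a measure \<Rightarrow> (nat \<Rightarrow> 'a \<Rightarrow> real) \<Rightarrow> (nat \<Rightarrow> 'a \<Rightarrow> int) \<Rightarrow> real \<Rightarrow> int \<Rightarrow> real" where
  "walk_law M \<tau> \<xi> s x = \<P>(\<omega> in M. position \<tau> \<xi> s \<omega> = x)"

text \<open>Since \<open>ln 0 = 0\<close>, the convention \<open>0 log 0 = 0\<close> holds automatically.\<close>

definition entropy_summand :: "(int \<Rightarrow> real) \<Rightarrow> int \<Rightarrow> real" where
  "entropy_summand \<nu> x = - \<nu> x * ln (\<nu> x)"

definition shannon_entropy :: "(int \<Rightarrow> real) \<Rightarrow> real" where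
  "shannon_entropy \<nu> = (\<Sum>\<^sub>\<infinity>x. entropy_summand \<nu> x)"

text \<open>Such walks exist for every step distribution.\<close>

lemma rate1_walk_exists:
  fixes step :: "int pmf"
  defines "P \<equiv> case_sum (\<lambda>_::nat. density lborel (exponential_density 1))
                     (\<lambda>_::nat. distr (measure_pmf step) borel real_of_int)"
  shows "rate1_walk (\<Pi>\<^sub>M k\<in>UNIV. P k) step (\<lambda>i \<omega>. \<omega> (Inl i)) (\<lambda>i \<omega>. \<lfloor>\<omega> (Inr i)\<rfloor>)"
proof -
  define W where "W = (\<Pi>\<^sub>M k\<in>UNIV. P k)"
  have P: "prob_space (P k)" for k
  proof (cases k)
    case (Inr i)
    then show ?thesis by (simp add: P_def measure_pmf.prob_space_distr)
  qed (simp add: P_def prob_space_exponential_density)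
  interpret W: prob_space W unfolding W_def by (intro prob_space_PiM P)
  have sets_P: "sets (P k) = sets borel" for k by (cases k) (simp_all add: P_def)
  have sets_W: "sets W = sets (\<Pi>\<^sub>M k\<in>UNIV. borel)"
    unfolding W_def by (intro sets_PiM_cong) (simp_all add: sets_P)
  have rv: "(\<lambda>\<omega>. \<omega> k) \<in> borel_measurable W" for k
    unfolding measurable_cong_sets[OF sets_W refl] by (rule measurable_component_singleton) simp
  have law: "distr W borel (\<lambda>\<omega>. \<omega> k) = P k" for k
  proof -
    have "distr W borel (\<lambda>\<omega>. \<omega> k) = distr W (P k) (\<lambda>\<omega>. \<omega> k)"
      by (rule distr_cong) (simp_all add: sets_P)
    also have "\<dots> = P k" unfolding W_def by (rule distr_PiM_component) (auto intro: P)
    finally show ?thesis .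
  qed
  have "distr W (\<Pi>\<^sub>M k\<in>UNIV. borel) (\<lambda>\<omega>. \<lambda>k\<in>UNIV. \<omega> k) = distr W W (\<lambda>\<omega>. \<omega>)"
    by (rule distr_cong) (simp_all add: sets_W restrict_def)
  also have "\<dots> = (\<Pi>\<^sub>M k\<in>UNIV. distr W borel (\<lambda>\<omega>. \<omega> k))"
    by (simp add: distr_id2 law) (simp add: W_def)
  finally have coords: "W.indep_vars (\<lambda>_. borel) (\<lambda>k \<omega>. \<omega> k) UNIV"
    by (subst W.indep_vars_iff_distr_eq_PiM') (simp_all add: rv)
  have "rate1_walk W step (\<lambda>i \<omega>. \<omega> (Inl i)) (\<lambda>i \<omega>. \<lfloor>\<omega> (Inr i)\<rfloor>)"
  proof
    fix i :: nat
    have "distr W lborel (\<lambda>\<omega>. \<omega> (Inl i)) = distr W borel (\<lambda>\<omega>. \<omega> (Inl i))"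
      by (rule distr_cong) simp_all
    then show "distributed W lborel (\<lambda>\<omega>. \<omega> (Inl i)) (\<lambda>x. ennreal (exponential_density 1 x))"
      unfolding distributed_def using rv[of "Inl i"] by (simp add: law P_def)
    have "distr W (count_space UNIV) (\<lambda>\<omega>. \<lfloor>\<omega> (Inr i)\<rfloor>)
        = distr (distr W borel (\<lambda>\<omega>. \<omega> (Inr i))) (count_space UNIV) floor"
      using rv[of "Inr i"] by (subst distr_distr) (simp_all add: comp_def)
    also have "\<dots> = distr (measure_pmf step) (count_space UNIV) (\<lambda>x. x)"
      unfolding law P_def sum.case by (subst distr_distr) (simp_all add: comp_def)
    also have "\<dots> = measure_pmf step" by (rule distr_id2) simp
    finally show "distr W (count_space UNIV) (\<lambda>\<omega>. \<lfloor>\<omega> (Inr i)\<rfloor>) = measure_pmf step" .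
  next
    have "W.indep_vars (\<lambda>_. borel)
      (\<lambda>k \<omega>. case_sum (\<lambda>_. (\<lambda>x. x)) (\<lambda>_ x. real_of_int \<lfloor>x\<rfloor>) k (\<omega> k)) UNIV"
      by (rule W.indep_vars_compose2[OF coords]) (auto split: sum.split)
    also have "(\<lambda>k \<omega>. case_sum (\<lambda>_. (\<lambda>x. x)) (\<lambda>_ x. real_of_int \<lfloor>x\<rfloor>) k (\<omega> k))
      = case_sum (\<lambda>i \<omega>. \<omega> (Inl i)) (\<lambda>i \<omega>. real_of_int \<lfloor>\<omega> (Inr i)\<rfloor>)"
      by (auto simp: fun_eq_iff split: sum.split)
    finally show "W.indep_vars (\<lambda>_. borel)
      (case_sum (\<lambda>i \<omega>. \<omega> (Inl i)) (\<lambda>i \<omega>. real_of_int \<lfloor>\<omega> (Inr i)\<rfloor>)) UNIV" .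
  qed
  then show ?thesis by (simp only: W_def)
qed

end

theory Submission
  imports Defs
begin

text \<open>The walk has mean \<open>m = s * \<mu>\<close>, where \<open>\<mu>\<close> is the mean of a jump, and variance \<open>s\<close>, because all jumps
  have square \<open>1\<close>. The entropy of a Gaussian with this variance is \<open>1/2 * ln (2 * pi * e * s)\<close>, and the proof
  compares the entropy \<open>H\<close> of the walk with it from both sides. The error obtained is \<open>O(1/s)\<close> for
  \<open>s \<ge> 1\<close>.

  \<^emph>\<open>Upper bound.\<close> By Gibbs' inequality, \<open>H\<close> is at most the cross entropy of the law of the walk with
  respect to the Gaussian rounded to the nearest integer. The negative logarithm of the rounded
  Gaussian is bounded by a quadratic polynomial in \<open>x\<close>, so only the variance of the walk enters
  (\<open>nn_walk_entropy_upper\<close>).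

  \<^emph>\<open>Lower bound.\<close> This needs a pointwise upper bound on the probabilities \<open>\<nu> x\<close> that is accurate enough
  after averaging \<open>- ln (\<nu> x)\<close>. Exponential tilting turns the walk into another nearest-neighbour walk
  with a different jump rate (\<open>pmf_nn_walk_tilt\<close>), and Fourier inversion bounds all point probabilities
  of all these walks by \<open>(1 + O(1/t)) / sqrt (2 * pi * t)\<close> when the rate is \<open>t\<close> (\<open>pmf_nn_walk_le\<close>).
  With \<open>M\<close> the moment generating function of a jump, this gives for every \<open>y\<close>
  \<open>- ln (\<nu> x) \<ge> y * x - s * (M y - 1) + 1/2 * ln (2 * pi * s * M y) - O(1 / (s * M y))\<close>.
  The choice \<open>y = (x - m) / s\<close> makes the expectation of the right-hand side computable from the variance
  and the exponential moments of order \<open>\<plusminus> 1/s\<close> (\<open>nn_walk_entropy_lower\<close>).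

  The law of the walk at time \<open>s\<close> is identified as compound Poisson from the Erlang distribution of the
  arrival times (\<open>walk_law_eq\<close>).\<close>

section \<open>Nearest-neighbour walks\<close>

text \<open>Both walks are nearest-neighbour walks, with probability \<open>p = 1/2\<close> or \<open>p = 1\<close> for an upward jump. A general \<open>p\<close> is
  needed in any case, because exponential tilting changes it.\<close>

definition nn_step :: "real \<Rightarrow> int pmf" where
  "nn_step p = map_pmf (\<lambda>b. if b then 1 else - 1) (bernoulli_pmf p)"

primrec nn_sum :: "real \<Rightarrow> nat \<Rightarrow> int pmf" where
  "nn_sum p 0 = return_pmf 0"
| "nn_sum p (Suc n) = bind_pmf (nn_step p) (\<lambda>y. map_pmf (\<lambda>x. x + y) (nn_sum p n))"

declare nn_sum.simps(2) [simp del]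

text \<open>The compound Poisson law of the position at time \<open>s\<close>.\<close>

definition nn_walk :: "real \<Rightarrow> real \<Rightarrow> int pmf" where
  "nn_walk p s = bind_pmf (poisson_pmf s) (nn_sum p)"

lemma simple_step_eq: "simple_step = nn_step (1/2)"
  unfolding simple_step_def nn_step_def bernoulli_pmf_half_conv_pmf_of_set
  by (subst map_pmf_of_set_inj) (auto simp: inj_on_def UNIV_bool insert_commute)

lemma directed_step_eq: "directed_step = nn_step 1"
proof -
  have "bernoulli_pmf 1 = return_pmf True"
    by (rule pmf_eqI) (auto simp: split: split_indicator)
  then show ?thesis by (simp add: directed_step_def nn_step_def)
qed

lemma nn_integral_nn_step:
  assumes "0 \<le> p" "p \<le> 1"
  shows "(\<integral>\<^sup>+y. f y \<partial>nn_step p) = ennreal p * f 1 + ennreal (1 - p) * f (-1)"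
  using assms by (simp add: nn_step_def mult.commute)

lemma pmf_nn_sum_Suc:
  assumes "0 \<le> p" "p \<le> 1"
  shows "pmf (nn_sum p (Suc n)) x = p * pmf (nn_sum p n) (x - 1) + (1 - p) * pmf (nn_sum p n) (x + 1)"
proof -
  have *: "pmf (map_pmf (\<lambda>x. x + y) (nn_sum p n)) x = pmf (nn_sum p n) (x - y)" for y x
    using pmf_map_inj'[of "\<lambda>x. x + y" "nn_sum p n" "x - y"] by (simp add: inj_def)
  have "ennreal (pmf (nn_sum p (Suc n)) x) = ennreal p * pmf (nn_sum p n) (x - 1) + ennreal (1 - p) * pmf (nn_sum p n) (x + 1)"
    by (simp add: nn_sum.simps(2) ennreal_pmf_bind nn_integral_nn_step[OF assms] *)
  also have "\<dots> = ennreal (p * pmf (nn_sum p n) (x - 1) + (1 - p) * pmf (nn_sum p n) (x + 1))"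
    using assms by (simp add: ennreal_mult ennreal_plus)
  finally show ?thesis using assms by (subst (asm) ennreal_inj) auto
qed

lemma nn_walk_sums:
  assumes "0 < s"
  shows "(\<lambda>n. s ^ n / fact n * exp (- s) * pmf (nn_sum p n) x) sums pmf (nn_walk p s) x"
proof -
  have "ennreal (pmf (nn_walk p s) x) = (\<Sum>n. ennreal (s ^ n / fact n * exp (- s) * pmf (nn_sum p n) x))"
    using assms by (simp add: nn_walk_def ennreal_pmf_bind nn_integral_measure_pmf
        nn_integral_count_space_nat flip: ennreal_mult)
  then have "(\<lambda>n. ennreal (s ^ n / fact n * exp (- s) * pmf (nn_sum p n) x)) sums ennreal (pmf (nn_walk p s) x)"
    by (simp add: sums_iff)
  then show ?thesis using assms by (subst (asm) sums_ennreal) auto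
qed

definition step_mgf :: "real \<Rightarrow> real \<Rightarrow> real" where
  "step_mgf p y = p * exp y + (1 - p) * exp (- y)"

lemma step_mgf_pos: "0 \<le> p \<Longrightarrow> p \<le> 1 \<Longrightarrow> 0 < step_mgf p y"
  unfolding step_mgf_def by (cases "p = 0") (auto intro: add_pos_nonneg)

text \<open>The tilted step law gives each jump \<open>x\<close> a weight proportional to its old probability times
  \<open>exp (y * x)\<close>; \<open>tilt p y\<close> is its probability of an upward jump.\<close>

definition tilt :: "real \<Rightarrow> real \<Rightarrow> real" where
  "tilt p y = p * exp y / step_mgf p y"

lemma tilt_bounds:
  assumes "0 \<le> p" "p \<le> 1"
  shows "0 \<le> tilt p y" "tilt p y \<le> 1"
  using assms step_mgf_pos[OF assms, of y] by (auto simp: tilt_def step_mgf_def)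

lemma pmf_nn_sum_tilt:
  assumes "0 \<le> p" "p \<le> 1"
  shows "pmf (nn_sum p n) x * exp (y * x) = step_mgf p y ^ n * pmf (nn_sum (tilt p y) n) x"
proof (induction n arbitrary: x)
  case 0
  then show ?case by (simp split: split_indicator)
next
  case (Suc n)
  let ?M = "step_mgf p y" and ?q = "tilt p y"
  have M: "?M > 0" using step_mgf_pos[OF assms] .
  have q: "?M * ?q = p * exp y" "?M * (1 - ?q) = (1 - p) * exp (- y)"
    using M by (auto simp: tilt_def right_diff_distrib step_mgf_def)
  have "pmf (nn_sum p (Suc n)) x * exp (y * x)
      = p * exp y * (pmf (nn_sum p n) (x - 1) * exp (y * of_int (x - 1)))
        + (1 - p) * exp (- y) * (pmf (nn_sum p n) (x + 1) * exp (y * of_int (x + 1)))"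
    by (simp add: pmf_nn_sum_Suc[OF assms] distrib_left right_diff_distrib exp_add exp_diff exp_minus field_simps)
  also have "\<dots> = ?M * ?q * (?M ^ n * pmf (nn_sum ?q n) (x - 1)) + ?M * (1 - ?q) * (?M ^ n * pmf (nn_sum ?q n) (x + 1))"
    by (simp only: Suc.IH q)
  also have "\<dots> = ?M ^ Suc n * pmf (nn_sum ?q (Suc n)) x"
    by (subst pmf_nn_sum_Suc[OF tilt_bounds[OF assms]]) (simp add: algebra_simps)
  finally show ?case .
qed

text \<open>A tilted compound Poisson law is again compound Poisson: every one of the \<open>n\<close> jumps contributes a
  factor \<open>step_mgf p y\<close>, which turns the jump rate \<open>s\<close> into \<open>s * step_mgf p y\<close>. Summation over \<open>x\<close>
  yields the moment generating function below, with its integrability.\<close>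

lemma pmf_nn_walk_tilt:
  assumes "0 \<le> p" "p \<le> 1" "0 < s"
  shows "pmf (nn_walk p s) x * exp (y * x)
    = exp (s * (step_mgf p y - 1)) * pmf (nn_walk (tilt p y) (s * step_mgf p y)) x"
proof -
  let ?M = "step_mgf p y"
  have M: "s * ?M > 0" using step_mgf_pos[OF assms(1,2)] assms(3) by simp
  have "(\<lambda>n. s ^ n / fact n * exp (- s) * pmf (nn_sum p n) x * exp (y * x)) sums (pmf (nn_walk p s) x * exp (y * x))"
    by (intro sums_mult2 nn_walk_sums assms)
  moreover have "(\<lambda>n. exp (s * (?M - 1)) * ((s * ?M) ^ n / fact n * exp (- (s * ?M)) * pmf (nn_sum (tilt p y) n) x))
      sums (exp (s * (?M - 1)) * pmf (nn_walk (tilt p y) (s * ?M)) x)"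
    by (intro sums_mult nn_walk_sums M)
  moreover have "s ^ n / fact n * exp (- s) * pmf (nn_sum p n) x * exp (y * x)
     = exp (s * (?M - 1)) * ((s * ?M) ^ n / fact n * exp (- (s * ?M)) * pmf (nn_sum (tilt p y) n) x)" for n
  proof -
    have "s ^ n / fact n * exp (- s) * pmf (nn_sum p n) x * exp (y * x)
        = s ^ n / fact n * exp (- s) * (?M ^ n * pmf (nn_sum (tilt p y) n) x)"
      unfolding pmf_nn_sum_tilt[OF assms(1,2), symmetric] by simp
    moreover have e: "exp (- s) = exp (s * (?M - 1)) * exp (- (s * ?M))"
      by (simp add: algebra_simps flip: exp_add)
    ultimately show ?thesis by (simp add: power_mult_distrib)
  qed
  ultimately show ?thesis using sums_unique2 by simp
qed

lemma nn_walk_exp_moment: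
  assumes "0 \<le> p" "p \<le> 1" "0 < s"
  shows "has_bochner_integral (nn_walk p s) (\<lambda>x. exp (y * of_int x)) (exp (s * (step_mgf p y - 1)))"
proof (rule has_bochner_integral_nn_integral)
  have "(\<integral>\<^sup>+x. ennreal (exp (y * of_int x)) \<partial>nn_walk p s)
    = (\<integral>\<^sup>+x. ennreal (exp (s * (step_mgf p y - 1))) * ennreal (pmf (nn_walk (tilt p y) (s * step_mgf p y)) x) \<partial>count_space UNIV)"
    using pmf_nn_walk_tilt[OF assms]
    by (simp add: nn_integral_measure_pmf flip: ennreal_mult'')
  also have "\<dots> = ennreal (exp (s * (step_mgf p y - 1)))"
    by (simp add: nn_integral_cmult nn_integral_pmf emeasure_pmf_UNIV)
  finally show "(\<integral>\<^sup>+x. ennreal (exp (y * of_int x)) \<partial>nn_walk p s) = ennreal (exp (s * (step_mgf p y - 1)))" .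
qed auto

text \<open>All factorial moments of a Poisson variable \<open>N\<close> follow from \<open>E (N * g (N - 1)) = s * E (g N)\<close>.\<close>

lemma poisson_shift_sums:
  fixes g :: "nat \<Rightarrow> real"
  assumes "(\<lambda>n. s ^ n / fact n * exp (- s) * g n) sums S"
  shows "(\<lambda>n. s ^ n / fact n * exp (- s) * (n * g (n - 1))) sums (s * S)"
proof -
  have eq: "s ^ Suc n / fact (Suc n) * exp (- s) * (Suc n * g (Suc n - 1)) = s * (s ^ n / fact n * exp (- s) * g n)" for n
    by (simp add: field_simps del: of_nat_Suc)
  have "(\<lambda>n. s ^ Suc n / fact (Suc n) * exp (- s) * (Suc n * g (Suc n - 1))) sums (s * S)"
    unfolding eq by (intro sums_mult assms)
  then show ?thesis by (subst (asm) sums_Suc_iff) simp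
qed

lemma poisson_second_moment:
  fixes s a b c :: real
  shows "(\<lambda>n. s ^ n / fact n * exp (- s) * (a * (real n)\<^sup>2 + b * real n + c)) sums (a * (s^2 + s) + b * s + c)"
proof -
  have 0: "(\<lambda>n. s ^ n / fact n * exp (- s) * 1) sums 1"
    using sums_mult2[OF exp_converges[of s], of "exp (-s)"] by (simp add: field_simps exp_minus)
  have 1: "(\<lambda>n. s ^ n / fact n * exp (- s) * n) sums s"
    using poisson_shift_sums[OF 0] by simp
  have "(\<lambda>n. s ^ n / fact n * exp (- s) * (real n * real (n - 1))) sums (s * s)"
    using poisson_shift_sums[OF 1] by simp
  from sums_add[OF sums_add[OF sums_mult[OF this, of a] sums_mult[OF 1, of "a + b"]] sums_mult[OF 0, of c]]
  have "(\<lambda>n. a * (s ^ n / fact n * exp (- s) * (real n * real (n - 1))) + (a + b) * (s ^ n / fact n * exp (- s) * n)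
     + c * (s ^ n / fact n * exp (- s) * 1)) sums (a * (s * s) + (a + b) * s + c)" by simp
  also have "(\<lambda>n. a * (s ^ n / fact n * exp (- s) * (real n * real (n - 1))) + (a + b) * (s ^ n / fact n * exp (- s) * n)
     + c * (s ^ n / fact n * exp (- s) * 1)) = (\<lambda>n. s ^ n / fact n * exp (- s) * (a * (real n)\<^sup>2 + b * real n + c))"
  proof
    fix n :: nat
    have n2: "real n * real (n - 1) = (real n)\<^sup>2 - real n" by (cases n) (auto simp: power2_eq_square algebra_simps)
    show "a * (s ^ n / fact n * exp (- s) * (real n * real (n - 1))) + (a + b) * (s ^ n / fact n * exp (- s) * n)
     + c * (s ^ n / fact n * exp (- s) * 1) = s ^ n / fact n * exp (- s) * (a * (real n)\<^sup>2 + b * real n + c)"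
      unfolding n2 by (simp add: algebra_simps add_divide_distrib diff_divide_distrib)
  qed
  finally show ?thesis by (simp add: algebra_simps power2_eq_square)
qed

text \<open>The centre \<open>c\<close> is kept arbitrary for two reasons: the induction over the jumps shifts it, and
  comparing the values \<open>c = 0\<close> and \<open>c = 1\<close> will give the mean without a separate computation.\<close>

lemma nn_sum_second_moment:
  assumes "0 \<le> p" "p \<le> 1"
  shows "(\<integral>\<^sup>+x. ennreal ((of_int x - c)\<^sup>2) \<partial>nn_sum p n)
    = ennreal (real n * (1 - (2 * p - 1)\<^sup>2) + (real n * (2 * p - 1) - c)\<^sup>2)"
proof (induction n arbitrary: c)
  case 0
  then show ?case by simp
next
  case (Suc n)
  have V: "0 \<le> 1 - (2 * p - 1)\<^sup>2"
    using assms abs_square_le_1[of "2 * p - 1"] by (simp add: abs_le_iff)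
  have *: "(\<integral>\<^sup>+x. ennreal ((of_int (x + y) - c)\<^sup>2) \<partial>nn_sum p n)
    = ennreal (real n * (1 - (2 * p - 1)\<^sup>2) + (real n * (2 * p - 1) - (c - of_int y))\<^sup>2)" for y
    using Suc[of "c - of_int y"] by (simp add: algebra_simps)
  let ?W = "\<lambda>d. real n * (1 - (2 * p - 1)\<^sup>2) + (real n * (2 * p - 1) - d)\<^sup>2"
  have "(\<integral>\<^sup>+x. ennreal ((of_int x - c)\<^sup>2) \<partial>nn_sum p (Suc n)) = ennreal (p * ?W (c - 1) + (1 - p) * ?W (c + 1))"
    using assms V
    by (simp add: nn_sum.simps(2) nn_integral_nn_step[OF assms] * del: of_int_add flip: ennreal_mult ennreal_plus)
  also have "p * ?W (c - 1) + (1 - p) * ?W (c + 1)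
      = real (Suc n) * (1 - (2 * p - 1)\<^sup>2) + (real (Suc n) * (2 * p - 1) - c)\<^sup>2"
    by (simp add: power2_eq_square algebra_simps)
  finally show ?case .
qed

text \<open>At \<open>c = s * (2 * p - 1)\<close> this is the variance, which is \<open>s\<close> for every \<open>p\<close> since all jumps have
  square \<open>1\<close>.\<close>

lemma nn_walk_second_moment:
  assumes "0 \<le> p" "p \<le> 1" "0 < s"
  shows "has_bochner_integral (nn_walk p s) (\<lambda>x. (of_int x - c)\<^sup>2) (s + (s * (2 * p - 1) - c)\<^sup>2)"
proof (rule has_bochner_integral_nn_integral)
  define \<mu> where "\<mu> = 2 * p - 1"
  have V: "0 \<le> 1 - \<mu>\<^sup>2"
    using assms abs_square_le_1[of \<mu>] by (simp add: \<mu>_def abs_le_iff)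
  have "(\<lambda>n. s ^ n / fact n * exp (- s) * (\<mu>\<^sup>2 * (real n)\<^sup>2 + (1 - \<mu>\<^sup>2 - 2 * \<mu> * c) * n + c\<^sup>2))
      sums (\<mu>\<^sup>2 * (s\<^sup>2 + s) + (1 - \<mu>\<^sup>2 - 2 * \<mu> * c) * s + c\<^sup>2)"
    by (rule poisson_second_moment)
  then have S: "(\<lambda>n. s ^ n / fact n * exp (- s) * (real n * (1 - \<mu>\<^sup>2) + (real n * \<mu> - c)\<^sup>2)) sums (s + (s * \<mu> - c)\<^sup>2)"
    by (simp add: power2_eq_square algebra_simps)
  have "(\<integral>\<^sup>+x. ennreal ((of_int x - c)\<^sup>2) \<partial>nn_walk p s)
    = (\<Sum>n. ennreal (s ^ n / fact n * exp (- s) * (real n * (1 - \<mu>\<^sup>2) + (real n * \<mu> - c)\<^sup>2)))"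
    using assms V
    by (simp add: nn_walk_def nn_sum_second_moment nn_integral_measure_pmf[of "poisson_pmf s"]
      nn_integral_count_space_nat flip: \<mu>_def ennreal_mult ennreal_plus)
  also have "\<dots> = ennreal (s + (s * \<mu> - c)\<^sup>2)"
    using S assms V by (intro sums_unique[symmetric]) (simp add: sums_ennreal flip: ennreal_plus)
  finally show "(\<integral>\<^sup>+x. ennreal ((of_int x - c)\<^sup>2) \<partial>nn_walk p s) = ennreal (s + (s * (2 * p - 1) - c)\<^sup>2)"
    by (simp add: \<mu>_def)
qed (use assms in auto)

lemma nn_walk_mean:
  assumes "0 \<le> p" "p \<le> 1" "0 < s"
  shows "has_bochner_integral (nn_walk p s) of_int (s * (2 * p - 1))"
proof -
  note m = nn_walk_second_moment[OF assms]
  have "has_bochner_integral (nn_walk p s) (\<lambda>x. ((of_int x - 0)\<^sup>2 - (of_int x - 1)\<^sup>2 + 1) / 2)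
    (((s + (s * (2 * p - 1) - 0)\<^sup>2) - (s + (s * (2 * p - 1) - 1)\<^sup>2) + 1) / 2)"
    by (intro has_bochner_integral_divide has_bochner_integral_add has_bochner_integral_diff m) 
       (simp_all add: has_bochner_integral_iff)
  then show ?thesis by (simp add: power2_eq_square algebra_simps diff_divide_distrib add_divide_distrib)
qed

section \<open>A uniform bound on the point probabilities\<close>

lemma sin_ge_cubic:
  fixes x :: real
  assumes "0 \<le> x"
  shows "x - x ^ 3 / 6 \<le> sin x"
proof -
  have c: "1 - y\<^sup>2 / 2 \<le> cos y" for y :: real
  proof -
    have "\<bar>sin (y / 2)\<bar> \<le> \<bar>y / 2\<bar>" by (rule abs_sin_x_le_abs_x)
    then have "(sin (y / 2))\<^sup>2 \<le> (y / 2)\<^sup>2" by (simp only: abs_le_square_iff)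
    then show ?thesis using cos_double_sin[of "y / 2"] by (simp add: power_divide)
  qed
  have "sin 0 - (0 - 0 ^ 3 / 6) \<le> sin x - (x - x ^ 3 / 6)"
  proof (rule DERIV_nonneg_imp_nondecreasing[OF assms])
    fix y :: real
    have "((\<lambda>x. sin x - (x - x ^ 3 / 6)) has_real_derivative (cos y - (1 - 3 * y\<^sup>2 / 6))) (at y)"
      by (auto intro!: derivative_eq_intros)
    then show "\<exists>d. ((\<lambda>x. sin x - (x - x ^ 3 / 6)) has_real_derivative d) (at y) \<and> 0 \<le> d"
      using c[of y] by (intro exI[of _ "cos y - (1 - 3 * y\<^sup>2 / 6)"]) simp
  qed
  then show ?thesis by simp
qed

text \<open>The first bound is sharp to fourth order at \<open>0\<close> and produces the Gaussian integral with the correct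
  constant; the second one is crude but positive on the whole period. Both come from the cubic bound
  for \<open>sin (\<theta> / 2)\<close>, where \<open>\<bar>\<theta> / 2\<bar> \<le> pi / 2 < 2\<close>.\<close>

lemma one_minus_cos_ge:
  fixes \<theta> :: real
  assumes "\<bar>\<theta>\<bar> \<le> pi"
  shows "\<theta>\<^sup>2 / 2 - \<theta> ^ 4 / 24 \<le> 1 - cos \<theta>" "\<theta>\<^sup>2 / 18 \<le> 1 - cos \<theta>"
proof -
  define x where "x = \<bar>\<theta>\<bar> / 2"
  have x: "0 \<le> x" "x \<le> 2" using assms pi_half_less_two by (auto simp: x_def)
  have \<theta>: "\<bar>\<theta>\<bar> = 2 * x" by (simp add: x_def)
  have c: "1 - cos \<theta> = 2 * (sin x)\<^sup>2"
    using cos_double_sin[of x] by (simp add: \<theta>[symmetric])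
  have x2: "x\<^sup>2 \<le> 4" using x power_mono[of x 2 2] by simp
  have "x * (x\<^sup>2 / 6) \<le> x * (2/3)" using x x2 by (intro mult_left_mono) auto
  then have "x ^ 3 / 6 \<le> x * 2 / 3" by (simp add: power2_eq_square power3_eq_cube)
  then have s: "x / 3 \<le> x - x ^ 3 / 6" by simp
  have "(x - x ^ 3 / 6)\<^sup>2 \<le> (sin x)\<^sup>2" "(x / 3)\<^sup>2 \<le> (sin x)\<^sup>2"
    using sin_ge_cubic[OF x(1)] s x by (auto intro!: power_mono)
  moreover have "(x - x ^ 3 / 6)\<^sup>2 \<ge> x\<^sup>2 - x ^ 4 / 3"
    using zero_le_power[OF x(1), of 6]
    by (simp add: power2_eq_square power3_eq_cube power4_eq_xxxx algebra_simps eval_nat_numeral)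
  moreover have "\<theta>\<^sup>2 = 4 * x\<^sup>2" "\<theta> ^ 4 = 16 * x ^ 4"
    using \<theta> power2_abs[of \<theta>] power_even_abs[of 4 \<theta>] by (simp_all add: power_mult_distrib)
  ultimately show "\<theta>\<^sup>2 / 2 - \<theta> ^ 4 / 24 \<le> 1 - cos \<theta>" "\<theta>\<^sup>2 / 18 \<le> 1 - cos \<theta>"
    by (simp_all add: c power_divide)
qed

lemma gaussian_integral:
  fixes t :: real
  assumes "0 < t"
  shows "has_bochner_integral lborel (\<lambda>x. exp (- (t * x\<^sup>2 / 2))) (sqrt (2 * pi / t))"
proof -
  let ?\<sigma> = "1 / sqrt t"
  have "has_bochner_integral lborel (\<lambda>x. sqrt (2 * pi / t) * normal_density 0 ?\<sigma> x) (sqrt (2 * pi / t) * 1)"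
    using assms by (intro has_bochner_integral_mult_right) (simp add: has_bochner_integral_iff)
  moreover have "sqrt (2 * pi / t) * normal_density 0 ?\<sigma> x = exp (- (t * x\<^sup>2 / 2))" for x
    using assms by (simp add: normal_density_def power_divide)
  ultimately show ?thesis by simp
qed

text \<open>The difference of the exponentials is at most the difference \<open>t * \<theta> ^ 4 / 24\<close> of the exponents times
  \<open>exp (- w)\<close>, where \<open>w = t * \<theta>\<^sup>2 / 18\<close>. Since \<open>t * \<theta> ^ 4\<close> is a multiple of \<open>w\<^sup>2 / t\<close>, half of the decay of
  \<open>exp (- w)\<close> absorbs \<open>w\<^sup>2\<close> and the gain \<open>1 / t\<close> remains.\<close>

lemma exp_cos_le:
  fixes t \<theta> :: real
  assumes "0 < t" "\<bar>\<theta>\<bar> \<le> pi"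
  shows "exp (- (t * (1 - cos \<theta>))) \<le> exp (- (t * \<theta>\<^sup>2 / 2)) + 108 / t * exp (- (t / 18 * \<theta>\<^sup>2 / 2))"
proof -
  define A B w where "A = t * (1 - cos \<theta>)" and "B = t * \<theta>\<^sup>2 / 2" and "w = t * \<theta>\<^sup>2 / 18"
  note c = one_minus_cos_ge[OF assms(2)]
  have wA: "w \<le> A" using mult_left_mono[OF c(2), of t] assms(1) by (simp add: w_def A_def)
  have w0: "0 \<le> w" using assms by (simp add: w_def)
  have "t * (\<theta>\<^sup>2 / 2 - \<theta> ^ 4 / 24) \<le> A"
    unfolding A_def using c(1) assms(1) by (intro mult_left_mono) auto
  then have BA: "B - A \<le> t * \<theta> ^ 4 / 24" by (simp add: B_def algebra_simps)
  have w2: "t * \<theta> ^ 4 / 24 = 27 / 2 * w\<^sup>2 / t"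
    using assms(1) by (simp add: w_def power2_eq_square power4_eq_xxxx)
  have "w\<^sup>2 \<le> 8 * exp (w / 2)"
  proof -
    have "1 + w / 2 + (w / 2)\<^sup>2 / 2 \<le> exp (w / 2)" using w0 by (intro exp_lower_Taylor_quadratic) simp
    then show ?thesis using w0 by (simp add: power_divide)
  qed
  then have "w\<^sup>2 * exp (- w) \<le> 8 * exp (w / 2) * exp (- w)" by (intro mult_right_mono) auto
  also have "\<dots> = 8 * exp (- (w / 2))" by (simp flip: exp_add)
  finally have w3: "w\<^sup>2 * exp (- w) \<le> 8 * exp (- (w / 2))" .
  have "exp (- A) - exp (- B) \<le> t * \<theta> ^ 4 / 24 * exp (- w)"
  proof -
    have "1 - exp (A - B) \<le> B - A" using exp_ge_add_one_self[of "A - B"] by linarith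
    then have "exp (- A) * (1 - exp (A - B)) \<le> exp (- A) * (B - A)"
      by (intro mult_left_mono) auto
    also have "\<dots> \<le> exp (- A) * (t * \<theta> ^ 4 / 24)" using BA by (intro mult_left_mono) auto
    also have "\<dots> \<le> exp (- w) * (t * \<theta> ^ 4 / 24)" using wA assms(1) by (intro mult_right_mono) auto
    finally show ?thesis by (simp add: algebra_simps flip: exp_add)
  qed
  also have "\<dots> = 27 / 2 / t * (w\<^sup>2 * exp (- w))" by (simp add: w2)
  also have "\<dots> \<le> 27 / 2 / t * (8 * exp (- (w / 2)))" using w3 assms(1) by (intro mult_left_mono) auto
  finally show ?thesis by (simp add: A_def B_def w_def)
qed

lemma integral_exp_cos_le:
  fixes t :: real
  assumes "0 < t"
  shows "(\<integral>\<theta>. exp (- (t * (1 - cos \<theta>))) \<partial>restrict_space lborel {-pi..pi}) \<le> sqrt (2 * pi / t) * (1 + 540 / t)"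
proof -
  let ?g = "\<lambda>\<theta>::real. exp (- (t * \<theta>\<^sup>2 / 2)) + 108 / t * exp (- (t / 18 * \<theta>\<^sup>2 / 2))"
  have g: "has_bochner_integral lborel ?g (sqrt (2 * pi / t) + 108 / t * sqrt (2 * pi / (t / 18)))"
    using assms by (intro has_bochner_integral_add has_bochner_integral_mult_right gaussian_integral) auto
  have "(\<integral>\<theta>. exp (- (t * (1 - cos \<theta>))) \<partial>restrict_space lborel {-pi..pi})
      = (\<integral>\<theta>. indicator {-pi..pi} \<theta> *\<^sub>R exp (- (t * (1 - cos \<theta>))) \<partial>lborel)"
    by (rule integral_restrict_space) simp
  also have "\<dots> \<le> integral\<^sup>L lborel ?g"
  proof (rule integral_mono')
    show "integrable lborel ?g" using g by (rule integrable.intros)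
    fix \<theta> :: real
    show "indicator {-pi..pi} \<theta> *\<^sub>R exp (- (t * (1 - cos \<theta>))) \<le> ?g \<theta>"
      using exp_cos_le[OF assms, of \<theta>] assms by (auto split: split_indicator)
  qed (use assms in auto)
  also have "\<dots> = sqrt (2 * pi / t) + 108 / t * sqrt (2 * pi / (t / 18))"
    using g by (rule has_bochner_integral_integral_eq)
  also have "sqrt (2 * pi / (t / 18)) = sqrt (2 * pi / t) * sqrt 18"
    by (simp flip: real_sqrt_mult)
  also have "sqrt (2 * pi / t) + 108 / t * (sqrt (2 * pi / t) * sqrt 18) = sqrt (2 * pi / t) * (1 + 108 * sqrt 18 / t)"
    by (simp add: algebra_simps)
  also have "\<dots> \<le> sqrt (2 * pi / t) * (1 + 540 / t)"
  proof -
    have "sqrt 18 \<le> sqrt (5\<^sup>2)" by (intro real_sqrt_le_mono) simp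
    then have "108 * sqrt 18 \<le> 540" by simp
    then show ?thesis using assms by (intro mult_left_mono add_left_mono divide_right_mono) auto
  qed
  finally show ?thesis .
qed

lemma integral_cos_int:
  fixes k :: int
  shows "(\<integral>\<theta>. cos (k * \<theta>) \<partial>restrict_space lborel {-pi..pi}) = (if k = 0 then 2 * pi else 0)"
proof (cases "k = 0")
  case True
  have "(\<integral>\<theta>. 1 \<partial>restrict_space lborel {-pi..pi}) = 2 * pi"
    by (simp add: measure_restrict_space space_restrict_space)
  then show ?thesis using True by simp
next
  case False
  have "(\<integral>\<theta>. cos (k * \<theta>) \<partial>restrict_space lborel {-pi..pi}) = (\<integral>\<theta>. cos (k * \<theta>) * indicator {-pi..pi} \<theta> \<partial>lborel)"
    by (subst integral_restrict_space) (auto simp: mult.commute)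
  also have "\<dots> = sin (k * pi) / k - sin (k * (- pi)) / k"
    using False by (intro integral_FTC_Icc_real) (auto intro!: derivative_eq_intros continuous_intros)
  also have "\<dots> = 0" by (simp add: sin_int_times_real mult.commute)
  finally show ?thesis using False by simp
qed

text \<open>The characteristic function of a step.\<close>

definition step_char :: "real \<Rightarrow> real \<Rightarrow> complex" where
  "step_char p \<theta> = p * cis \<theta> + complex_of_real (1 - p) * cis (- \<theta>)"

lemma norm_step_char:
  assumes "0 \<le> p" "p \<le> 1"
  shows "norm (step_char p \<theta>) \<le> 1"
  using assms norm_triangle_ineq[of "p * cis \<theta>" "(1 - p) * cis (- \<theta>)"]
  by (simp add: step_char_def norm_mult del: of_real_diff)

text \<open>The real part does not depend on \<open>p\<close>; hence one bound serves all nearest-neighbour walks, in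
  particular all tilted ones.\<close>

lemma Re_step_char: "Re (step_char p \<theta>) = cos \<theta>"
  by (simp add: step_char_def algebra_simps)

lemma finite_measure_circle: "finite_measure (restrict_space lborel {-pi..pi})"
  by (rule finite_measureI) (simp add: emeasure_restrict_space space_restrict_space)

lemma integrable_circle:
  fixes f :: "real \<Rightarrow> real"
  assumes "continuous_on UNIV f" "\<And>\<theta>. \<bar>f \<theta>\<bar> \<le> B"
  shows "integrable (restrict_space lborel {-pi..pi}) f"
proof -
  have "f \<in> borel_measurable (restrict_space lborel {-pi..pi})"
    using borel_measurable_continuous_onI[OF assms(1)] by (intro measurable_restrict_space1) simp
  then show ?thesis using assms(2)
    by (intro finite_measure.integrable_const_bound[OF finite_measure_circle]) auto
qed

text \<open>The integrand in the Fourier inversion formula for the \<open>n\<close>-fold convolution of the step law.\<close>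

definition char_kernel :: "real \<Rightarrow> nat \<Rightarrow> int \<Rightarrow> real \<Rightarrow> real" where
  "char_kernel p n x \<theta> = Re (step_char p \<theta> ^ n * cis (- (of_int x * \<theta>)))"

lemma abs_char_kernel:
  assumes "0 \<le> p" "p \<le> 1"
  shows "\<bar>char_kernel p n x \<theta>\<bar> \<le> 1"
proof -
  have "\<bar>char_kernel p n x \<theta>\<bar> \<le> norm (step_char p \<theta>) ^ n"
    using abs_Re_le_cmod[of "step_char p \<theta> ^ n * cis (- (of_int x * \<theta>))"]
    by (simp only: char_kernel_def norm_mult norm_power norm_cis mult_1_right)
  also have "\<dots> \<le> 1" using norm_step_char[OF assms] by (intro power_le_one) auto
  finally show ?thesis .
qed

lemma integrable_char_kernel:
  assumes "0 \<le> p" "p \<le> 1"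
  shows "integrable (restrict_space lborel {-pi..pi}) (char_kernel p n x)"
proof (rule integrable_circle)
  show "continuous_on UNIV (char_kernel p n x)"
    unfolding char_kernel_def step_char_def by (intro continuous_intros)
qed (rule abs_char_kernel[OF assms])

lemma Re_complex_of_real_mult: "Re (complex_of_real a * z) = a * Re z"
  by simp

lemma char_kernel_Suc:
  "char_kernel p (Suc n) x \<theta> = p * char_kernel p n (x - 1) \<theta> + (1 - p) * char_kernel p n (x + 1) \<theta>"
proof -
  have "cis (- (of_int (x - 1) * \<theta>)) = cis \<theta> * cis (- (of_int x * \<theta>))"
    "cis (- (of_int (x + 1) * \<theta>)) = cis (- \<theta>) * cis (- (of_int x * \<theta>))"
    by (simp_all add: cis_mult algebra_simps)
  then have "step_char p \<theta> ^ Suc n * cis (- (of_int x * \<theta>))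
    = of_real p * (step_char p \<theta> ^ n * cis (- (of_int (x - 1) * \<theta>)))
    + of_real (1 - p) * (step_char p \<theta> ^ n * cis (- (of_int (x + 1) * \<theta>)))"
    by (simp add: step_char_def algebra_simps)
  then show ?thesis by (simp only: char_kernel_def plus_complex.sel Re_complex_of_real_mult)
qed

text \<open>Both sides satisfy the same recursion in \<open>n\<close>, so that only the orthogonality of the characters at
  \<open>n = 0\<close> is needed.\<close>

lemma pmf_nn_sum_fourier:
  assumes "0 \<le> p" "p \<le> 1"
  shows "2 * pi * pmf (nn_sum p n) x = (\<integral>\<theta>. char_kernel p n x \<theta> \<partial>restrict_space lborel {-pi..pi})"
proof (induction n arbitrary: x)
  case 0
  then show ?case by (simp add: char_kernel_def integral_cos_int)
next
  case (Suc n)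
  show ?case
    using integrable_char_kernel[OF assms, of n]
    by (simp add: pmf_nn_sum_Suc[OF assms] char_kernel_Suc distrib_left Suc.IH[symmetric])
qed

text \<open>Averaging the inversion formula over the Poisson number of jumps yields the characteristic function
  \<open>exp (t * (step_char p \<theta> - 1))\<close>, whose modulus is \<open>exp (- t * (1 - cos \<theta>))\<close>.\<close>

lemma pmf_nn_walk_le_integral:
  assumes "0 \<le> p" "p \<le> 1" "0 < t"
  shows "2 * pi * pmf (nn_walk p t) x \<le> (\<integral>\<theta>. exp (- (t * (1 - cos \<theta>))) \<partial>restrict_space lborel {-pi..pi})"
proof -
  let ?R = "restrict_space lborel {-pi..pi}"
  define P where "P n = t ^ n / fact n * exp (- t)" for n :: nat
  define f where "f n \<theta> = P n * char_kernel p n x \<theta>" for n \<theta>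
  have P0: "0 \<le> P n" for n using assms by (simp add: P_def)
  have P1: "summable P"
    unfolding P_def using summable_mult2[OF summable_exp[of t], of "exp (-t)"] by (simp add: field_simps)
  have fP: "norm (f n \<theta>) \<le> P n" for n \<theta>
    using mult_left_mono[OF abs_char_kernel[OF assms(1,2)] P0] P0 by (simp add: f_def abs_mult)
  have fi: "integrable ?R (f n)" for n
    unfolding f_def by (intro integrable_mult_right integrable_char_kernel assms)
  have ni: "(\<integral>\<theta>. norm (f n \<theta>) \<partial>?R) \<le> 2 * pi * P n" for n
  proof -
    have "(\<integral>\<theta>. norm (f n \<theta>) \<partial>?R) \<le> (\<integral>\<theta>. P n \<partial>?R)"
      using fi fP by (intro integral_mono integrable_norm finite_measure.integrable_const finite_measure_circle)
    also have "\<dots> = 2 * pi * P n" by (simp add: measure_restrict_space space_restrict_space)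
    finally show ?thesis .
  qed
  have sn: "summable (\<lambda>n. \<integral>\<theta>. norm (f n \<theta>) \<partial>?R)"
    by (rule summable_comparison_test'[OF summable_mult[OF P1, of "2 * pi"], of 0]) (use ni in simp)
  have sf: "summable (\<lambda>n. norm (f n \<theta>))" for \<theta>
    by (rule summable_comparison_test'[OF P1, of 0]) (use fP in simp)
  have "(\<lambda>n. 2 * pi * (P n * pmf (nn_sum p n) x)) sums (2 * pi * pmf (nn_walk p t) x)"
    unfolding P_def by (intro sums_mult nn_walk_sums assms)
  moreover have "2 * pi * (P n * pmf (nn_sum p n) x) = (\<integral>\<theta>. f n \<theta> \<partial>?R)" for n
    using pmf_nn_sum_fourier[OF assms(1,2), of n x] by (simp add: f_def)
  ultimately have "2 * pi * pmf (nn_walk p t) x = (\<Sum>n. \<integral>\<theta>. f n \<theta> \<partial>?R)"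
    by (simp add: sums_iff)
  also have "\<dots> = (\<integral>\<theta>. (\<Sum>n. f n \<theta>) \<partial>?R)"
    by (rule integral_suminf[symmetric]) (use fi sf sn in auto)
  also have "\<dots> \<le> (\<integral>\<theta>. exp (- (t * (1 - cos \<theta>))) \<partial>?R)"
  proof (rule integral_mono)
    show "integrable ?R (\<lambda>\<theta>. \<Sum>n. f n \<theta>)"
      by (rule integrable_suminf) (use fi sf sn in auto)
    show "integrable ?R (\<lambda>\<theta>. exp (- (t * (1 - cos \<theta>))))"
      using assms by (intro integrable_circle[where B=1]) (auto intro!: continuous_intros)
    fix \<theta>
    let ?\<phi> = "step_char p \<theta>" and ?c = "cis (- (of_int x * \<theta>))"
    have "(\<lambda>n. of_real t ^ n * ?\<phi> ^ n /\<^sub>R fact n) sums exp (of_real t * ?\<phi>)"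
      using exp_converges[of "of_real t * ?\<phi>"] by (simp add: power_mult_distrib)
    from sums_mult[OF this, of "of_real (exp (- t)) * ?c"]
    have "(\<lambda>n. of_real (P n) * (?\<phi> ^ n * ?c)) sums (of_real (exp (- t)) * ?c * exp (of_real t * ?\<phi>))"
      by (simp add: P_def scaleR_conv_of_real divide_inverse ac_simps)
    from sums_Re[OF this]
    have "(\<lambda>n. f n \<theta>) sums Re (of_real (exp (- t)) * ?c * exp (of_real t * ?\<phi>))"
      by (simp only: f_def char_kernel_def Re_complex_of_real_mult)
    then have "(\<Sum>n. f n \<theta>) \<le> norm (of_real (exp (- t)) * ?c * exp (of_real t * ?\<phi>))"
      using complex_Re_le_cmod sums_unique by metis
    also have "\<dots> = exp (- t) * exp (t * cos \<theta>)"
      by (simp add: norm_mult Re_step_char)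
    also have "\<dots> = exp (- (t * (1 - cos \<theta>)))"
      by (simp add: algebra_simps flip: exp_add)
    finally show "(\<Sum>n. f n \<theta>) \<le> exp (- (t * (1 - cos \<theta>)))" .
  qed
  finally show ?thesis .
qed

text \<open>The local limit theorem as a one-sided bound, uniform in \<open>p\<close> and \<open>x\<close>. Near the mean it
  is sharp to leading order for large \<open>t\<close>; the decay away from the mean is recovered by tilting.\<close>

lemma pmf_nn_walk_le:
  assumes "0 \<le> p" "p \<le> 1" "0 < t"
  shows "pmf (nn_walk p t) x \<le> (1 + 540 / t) / sqrt (2 * pi * t)"
proof -
  have "2 * pi * pmf (nn_walk p t) x \<le> sqrt (2 * pi / t) * (1 + 540 / t)"
    using pmf_nn_walk_le_integral[OF assms] integral_exp_cos_le[OF assms(3)] by (rule order_trans)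
  moreover have "sqrt (2 * pi / t) = 2 * pi / sqrt (2 * pi * t)"
  proof (rule real_sqrt_unique)
    show "(2 * pi / sqrt (2 * pi * t))\<^sup>2 = 2 * pi / t"
      using assms(3) by (simp add: power_divide power2_eq_square)
  qed (use assms in auto)
  ultimately have "2 * pi * pmf (nn_walk p t) x \<le> 2 * pi * ((1 + 540 / t) / sqrt (2 * pi * t))"
    by simp
  then show ?thesis by (subst (asm) mult_le_cancel_left_pos) auto
qed

section \<open>Upper bound for the entropy\<close>

definition cell :: "int \<Rightarrow> real set" where
  "cell x = {of_int x - 1/2..<of_int x + 1/2}"

lemma cell_round: "t \<in> cell x \<longleftrightarrow> x = \<lfloor>t + 1/2\<rfloor>"
  unfolding cell_def by (auto simp: floor_eq_iff intro: floor_unique) linarith+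

lemma gaussian_cells_total:
  assumes "0 < \<sigma>"
  shows "has_bochner_integral (count_space UNIV) (\<lambda>x. measure (density lborel (normal_density m \<sigma>)) (cell x)) 1"
proof -
  define N where "N = density lborel (normal_density m \<sigma>)"
  interpret N: prob_space N unfolding N_def by (rule prob_space_normal_density) fact
  define Q where "Q = (\<lambda>x. measure N (cell x))"
  have "(\<integral>\<^sup>+x. ennreal (Q x) \<partial>count_space UNIV) = (\<integral>\<^sup>+x. emeasure N (cell x) \<partial>count_space UNIV)"
    by (simp add: Q_def N.emeasure_eq_measure)
  also have "\<dots> = emeasure N (\<Union>x. cell x)"
    by (rule emeasure_UN_countable[symmetric]) (auto simp: N_def disjoint_family_on_def cell_round cell_def)
  also have "(\<Union>x. cell x) = space N" by (auto simp: N_def cell_round)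
  finally have 1: "(\<integral>\<^sup>+x. ennreal (Q x) \<partial>count_space UNIV) = 1" by (simp add: N.emeasure_space_1)
  show ?thesis
    using 1 by (intro has_bochner_integral_nn_integral) (simp_all add: Q_def N_def)
qed

text \<open>One term of Gibbs' inequality. The slack \<open>b - a\<close> sums to \<open>0\<close> over two probability distributions.\<close>

lemma gibbs_summand:
  fixes a b :: real
  assumes "0 \<le> a" "0 < b"
  shows "- a * ln a \<le> a * (- ln b) + (b - a)"
proof (cases "a = 0")
  case False
  have "a * (1 + ln (b / a)) \<le> a * (b / a)"
    using ln_le_minus_one[of "b / a"] False assms by (intro mult_left_mono) auto
  then show ?thesis using False assms by (simp add: ln_div algebra_simps)
qed (use assms in simp)

lemma has_bochner_integral_pmf_iff:
  fixes f :: "'b \<Rightarrow> real"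
  shows "has_bochner_integral (measure_pmf p) f a \<longleftrightarrow> has_bochner_integral (count_space UNIV) (\<lambda>x. pmf p x * f x) a"
  by (simp add: has_bochner_integral_iff measure_pmf_eq_density integrable_density integral_density)

lemma has_bochner_integral_pmf: "has_bochner_integral (count_space UNIV) (pmf p) 1"
  using has_bochner_integral_pmf_iff[of p "\<lambda>_. 1" 1] by (simp add: has_bochner_integral_iff)

lemma infsum_eq_count_space_integral:
  fixes f :: "'b \<Rightarrow> real"
  assumes "integrable (count_space UNIV) f"
  shows "f summable_on UNIV" "infsum f UNIV = integral\<^sup>L (count_space UNIV) f"
proof -
  have a: "Infinite_Set_Sum.abs_summable_on f UNIV"
    using assms by (simp add: Infinite_Set_Sum.abs_summable_on_def)
  show "f summable_on UNIV" using a abs_summable_equivalent abs_summable_summable by blast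
  show "infsum f UNIV = integral\<^sup>L (count_space UNIV) f"
    using infsetsum_infsum[OF a] by (simp add: infsetsum_def)
qed

text \<open>The entropy is at most the cross entropy with any other distribution \<open>q\<close>. The same termwise estimate
  shows that the entropy series converges.\<close>

lemma entropy_le_cross_entropy:
  fixes p :: "int pmf"
  assumes q: "has_bochner_integral (count_space UNIV) q 1" "\<And>x. 0 < q x"
    and L: "has_bochner_integral p L a" "\<And>x. - ln (q x) \<le> L x"
  shows "entropy_summand (pmf p) summable_on UNIV" "0 \<le> shannon_entropy (pmf p)" "shannon_entropy (pmf p) \<le> a"
proof -
  let ?h = "entropy_summand (pmf p)" and ?g = "\<lambda>x. pmf p x * L x + (q x - pmf p x)"
  have 0: "0 \<le> ?h x" for x
    using mult_nonneg_nonpos[OF pmf_nonneg[of p x], of "ln (pmf p x)"] pmf_le_1[of p x]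
    by (cases "pmf p x = 0") (auto simp: entropy_summand_def less_le ln_le_zero_iff)
  have hg: "?h x \<le> ?g x" for x
    using gibbs_summand[OF pmf_nonneg[of p x] q(2)[of x]] mult_left_mono[OF L(2)[of x] pmf_nonneg[of p x]]
    by (simp add: entropy_summand_def)
  have g: "has_bochner_integral (count_space UNIV) ?g (a + (1 - 1))"
    using L(1) unfolding has_bochner_integral_pmf_iff
    by (intro has_bochner_integral_add has_bochner_integral_diff q has_bochner_integral_pmf)
  have h: "integrable (count_space UNIV) ?h"
    by (rule Bochner_Integration.integrable_bound[OF integrable.intros[OF g]])
      (use 0 hg in \<open>auto intro!: AE_I2 order_trans[OF hg abs_ge_self]\<close>)
  show "?h summable_on UNIV" by (rule infsum_eq_count_space_integral[OF h])
  show "0 \<le> shannon_entropy (pmf p)"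
    unfolding shannon_entropy_def infsum_eq_count_space_integral(2)[OF h] using 0 by (intro integral_nonneg_AE) auto
  have "integral\<^sup>L (count_space UNIV) ?h \<le> integral\<^sup>L (count_space UNIV) ?g"
    using hg by (intro integral_mono h integrable.intros[OF g])
  also have "\<dots> = a" using has_bochner_integral_integral_eq[OF g] by simp
  finally show "shannon_entropy (pmf p) \<le> a"
    unfolding shannon_entropy_def infsum_eq_count_space_integral(2)[OF h] .
qed

lemma entropy_ge:
  fixes p :: "int pmf"
  assumes "entropy_summand (pmf p) summable_on UNIV"
    and R: "has_bochner_integral p R a" "\<And>x. 0 < pmf p x \<Longrightarrow> R x \<le> - ln (pmf p x)"
  shows "a \<le> shannon_entropy (pmf p)"
proof -
  have g: "has_bochner_integral (count_space UNIV) (\<lambda>x. pmf p x * R x) a"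
    using R(1) unfolding has_bochner_integral_pmf_iff .
  have le: "pmf p x * R x \<le> entropy_summand (pmf p) x" for x
  proof (cases "pmf p x = 0")
    case False
    then have "0 < pmf p x" by (simp add: pmf_positive_iff set_pmf_iff)
    from mult_left_mono[OF R(2)[OF this] pmf_nonneg] show ?thesis by (simp add: entropy_summand_def)
  qed (simp add: entropy_summand_def)
  have "(\<Sum>\<^sub>\<infinity>x. pmf p x * R x) \<le> shannon_entropy (pmf p)"
    unfolding shannon_entropy_def
    using le by (intro infsum_mono assms(1) infsum_eq_count_space_integral(1)[OF integrable.intros[OF g]])
  then show ?thesis
    using infsum_eq_count_space_integral(2)[OF integrable.intros[OF g]] has_bochner_integral_integral_eq[OF g] by simp
qed

text \<open>Jensen's inequality on a cell of length \<open>1\<close>: the logarithm of the integral of the density is at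
  least the integral of its logarithm, and \<open>(t - m)\<^sup>2\<close> has average \<open>(x - m)\<^sup>2 + 1/12\<close> over the cell. The
  proof integrates the tangent of the exponential at that average.\<close>

lemma gaussian_cell_ge:
  fixes s m :: real
  assumes "0 < s"
  shows "exp (- (((of_int x - m)\<^sup>2 + 1/12) / (2 * s))) / sqrt (2 * pi * s)
    \<le> measure (density lborel (normal_density m (sqrt s))) (cell x)"
proof -
  define N where "N = density lborel (normal_density m (sqrt s))"
  interpret N: prob_space N unfolding N_def by (rule prob_space_normal_density) (use assms in simp)
  define A where "A = ((of_int x - m)\<^sup>2 + 1/12) / (2 * s)"
  define K where "K = exp (- A) / sqrt (2 * pi * s)"
  define I where "I = {of_int x - 1/2..of_int x + 1/2 :: real}"
  define h where "h t = K * (1 + A - (t - m)\<^sup>2 / (2 * s))" for t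
  define F where "F t = K * (t + A * t - (t - m) ^ 3 / (6 * s))" for t
  have h_le: "h t \<le> normal_density m (sqrt s) t" for t
  proof -
    have "exp (- A) * (1 + (A - (t - m)\<^sup>2 / (2 * s))) \<le> exp (- A) * exp (A - (t - m)\<^sup>2 / (2 * s))"
      by (intro mult_left_mono exp_ge_add_one_self) auto
    also have "\<dots> = exp (- (t - m)\<^sup>2 / (2 * s))" by (simp flip: exp_add)
    finally show ?thesis
      using assms by (simp add: h_def K_def normal_density_def divide_right_mono add_diff_eq)
  qed
  have F: "(F has_real_derivative h t) (at t)" for t
    using assms unfolding F_def h_def
    by (auto intro!: derivative_eq_intros simp: field_simps)
  have hI: "has_bochner_integral lborel (\<lambda>t. h t * indicator I t) (F (of_int x + 1/2) - F (of_int x - 1/2))"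
    unfolding I_def using F
    by (intro has_bochner_integral_FTC_Icc_real) (use assms in \<open>auto simp: h_def intro!: continuous_intros\<close>)
  have "F (of_int x + 1/2) - F (of_int x - 1/2) = K * (1 + A - ((of_int x - m)\<^sup>2 + 1/12) / (2 * s))"
  proof -
    define d where "d = of_int x - m"
    have "(d + 1/2) ^ 3 - (d - 1/2) ^ 3 = 3 * d\<^sup>2 + 1/4"
      by (simp add: power3_eq_cube power2_eq_square algebra_simps)
    then have "(d + 1/2) ^ 3 / (6 * s) - (d - 1/2) ^ 3 / (6 * s) = (3 * d\<^sup>2 + 1/4) / (6 * s)"
      unfolding diff_divide_distrib[symmetric] by (rule arg_cong)
    also have "\<dots> = (d\<^sup>2 + 1/12) / (2 * s)" by (simp add: field_simps)
    finally have "(d + 1/2) ^ 3 / (6 * s) - (d - 1/2) ^ 3 / (6 * s) = (d\<^sup>2 + 1/12) / (2 * s)" .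
    moreover have "of_int x + 1/2 - m = d + 1/2" "of_int x - 1/2 - m = d - 1/2" by (simp_all add: d_def)
    ultimately show ?thesis unfolding F_def by (simp only: d_def[symmetric]) (simp add: algebra_simps)
  qed
  also have "\<dots> = K" by (simp add: A_def)
  finally have "K = (\<integral>t. h t * indicator I t \<partial>lborel)"
    using has_bochner_integral_integral_eq[OF hI] by simp
  also have "\<dots> \<le> (\<integral>t. normal_density m (sqrt s) t * indicator I t \<partial>lborel)"
  proof (rule integral_mono)
    show "integrable lborel (\<lambda>t. h t * indicator I t)" by (rule integrable.intros[OF hI])
    show "integrable lborel (\<lambda>t. normal_density m (sqrt s) t * indicator I t)"
      using assms by (intro integrable_real_mult_indicator) (auto simp: I_def)
    show "h t * indicator I t \<le> normal_density m (sqrt s) t * indicator I t" for t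
      using h_le[of t] by (intro mult_right_mono) auto
  qed
  also have "\<dots> = (\<integral>t. indicator I t \<partial>N)"
    unfolding N_def by (subst integral_density) (auto simp: I_def)
  also have "\<dots> = measure N I" by (simp add: N_def I_def)
  also have "\<dots> = measure N (cell x)"
  proof (rule measure_eq_AE)
    have "AE t in lborel. t \<noteq> of_int x + 1/2" by (rule AE_lborel_singleton)
    then show "AE t in N. t \<in> I \<longleftrightarrow> t \<in> cell x"
      unfolding N_def by (subst AE_density) (auto simp: I_def cell_def elim!: eventually_mono)
  qed (auto simp: N_def I_def cell_def)
  finally show ?thesis by (simp add: K_def A_def N_def)
qed

text \<open>The comparison distribution is the Gaussian with the mean and variance of the walk, rounded to the
  nearest integer. The term \<open>1 / (24 * s)\<close> is the price of the rounding.\<close>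

lemma nn_walk_entropy_upper:
  assumes p: "0 \<le> p" "p \<le> 1" and s: "0 < s"
  shows "entropy_summand (pmf (nn_walk p s)) summable_on UNIV"
    and "0 \<le> shannon_entropy (pmf (nn_walk p s))"
    and "shannon_entropy (pmf (nn_walk p s)) \<le> 1/2 * ln (2 * pi * exp 1 * s) + 1 / (24 * s)"
proof -
  define m where "m = s * (2 * p - 1)"
  define q where "q x = measure (density lborel (normal_density m (sqrt s))) (cell x)" for x
  define L where "L x = (of_int x - m)\<^sup>2 / (2 * s) + (1 / (24 * s) + ln (2 * pi * s) / 2)" for x :: int
  have K: "0 < exp (- (((of_int x - m)\<^sup>2 + 1/12) / (2 * s))) / sqrt (2 * pi * s)" for x
    using s by simp
  have q: "has_bochner_integral (count_space UNIV) q 1"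
    unfolding q_def using s by (intro gaussian_cells_total) simp
  have q0: "0 < q x" for x
    using less_le_trans[OF K gaussian_cell_ge[OF s]] by (simp add: q_def)
  have qL: "- ln (q x) \<le> L x" for x
  proof -
    have "ln (exp (- (((of_int x - m)\<^sup>2 + 1/12) / (2 * s))) / sqrt (2 * pi * s)) \<le> ln (q x)"
      using gaussian_cell_ge[OF s] K q0 by (subst ln_le_cancel_iff) (auto simp: q_def)
    then show ?thesis using s by (simp add: ln_div ln_sqrt L_def add_divide_distrib)
  qed
  have L: "has_bochner_integral (nn_walk p s) L ((s + (s * (2 * p - 1) - m)\<^sup>2) / (2 * s) + (1 / (24 * s) + ln (2 * pi * s) / 2))"
    unfolding L_def
    by (intro has_bochner_integral_add has_bochner_integral_divide nn_walk_second_moment assms)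
      (simp_all add: has_bochner_integral_iff)
  have "(s + (s * (2 * p - 1) - m)\<^sup>2) / (2 * s) + (1 / (24 * s) + ln (2 * pi * s) / 2)
    = 1/2 * ln (2 * pi * exp 1 * s) + 1 / (24 * s)"
    using s by (simp add: m_def ln_mult field_simps)
  with entropy_le_cross_entropy[OF q q0 L qL]
  show "entropy_summand (pmf (nn_walk p s)) summable_on UNIV"
    "0 \<le> shannon_entropy (pmf (nn_walk p s))"
    "shannon_entropy (pmf (nn_walk p s)) \<le> 1/2 * ln (2 * pi * exp 1 * s) + 1 / (24 * s)" by auto
qed

section \<open>Lower bound for the entropy\<close>

lemma exp_minus_tangent_le:
  fixes y :: real
  assumes "0 \<le> y"
  shows "exp (- y) - 1 + y \<le> exp y - 1 - y"
proof -
  have "exp 0 - exp (- 0) - 2 * 0 \<le> exp y - exp (- y) - 2 * y"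
  proof (rule DERIV_nonneg_imp_nondecreasing[OF assms])
    fix z :: real
    have "((\<lambda>y. exp y - exp (- y) - 2 * y) has_real_derivative (exp z + exp (- z) - 2)) (at z)"
      by (auto intro!: derivative_eq_intros)
    moreover have "0 \<le> exp z + exp (- z) - 2"
      using exp_ge_add_one_self[of z] exp_ge_add_one_self[of "- z"] by linarith
    ultimately show "\<exists>d. ((\<lambda>y. exp y - exp (- y) - 2 * y) has_real_derivative d) (at z) \<and> 0 \<le> d" by blast
  qed
  then show ?thesis by simp
qed

lemma exp_le_cubic:
  fixes y :: real
  assumes "0 \<le> y" "y \<le> 1"
  shows "exp y \<le> 1 + y + y\<^sup>2 / 2 + y ^ 3 / 2"
proof -
  let ?f = "\<lambda>y::real. 1 + y + y\<^sup>2 / 2 + y ^ 3 / 2 - exp y"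
  have "?f 0 \<le> ?f y"
  proof (rule DERIV_nonneg_imp_nondecreasing[OF assms(1)])
    fix z assume z: "0 \<le> z" "z \<le> y"
    have "(?f has_real_derivative (1 + z + 3 * z\<^sup>2 / 2 - exp z)) (at z)"
      by (auto intro!: derivative_eq_intros)
    moreover have "0 \<le> 1 + z + 3 * z\<^sup>2 / 2 - exp z"
      using exp_bound[of z] z assms zero_le_power2[of z] by linarith
    ultimately show "\<exists>d. (?f has_real_derivative d) (at z) \<and> 0 \<le> d" by blast
  qed
  then show ?thesis by simp
qed

text \<open>Cauchy-Schwarz for the variables \<open>exp (y * \<xi> / 2)\<close> and \<open>exp (- y * \<xi> / 2)\<close>, where \<open>\<xi>\<close> is a step.\<close>

lemma step_mgf_inverse:
  assumes "0 \<le> p" "p \<le> 1"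
  shows "1 / step_mgf p y \<le> step_mgf p (- y)"
proof -
  have "1 = exp y * exp (- y)" by (simp flip: exp_add)
  then have "step_mgf p y * step_mgf p (- y) = 1 + p * (1 - p) * (exp y - exp (- y))\<^sup>2"
    unfolding step_mgf_def power2_eq_square by (simp only: minus_minus) algebra
  then have "1 \<le> step_mgf p y * step_mgf p (- y)" using assms by simp
  then show ?thesis using step_mgf_pos[OF assms] by (simp add: divide_le_eq mult.commute)
qed

text \<open>Jensen's inequality for the exponential function; \<open>2 * p - 1\<close> is the mean of a step.\<close>

lemma step_mgf_ln_ge:
  assumes "0 \<le> p" "p \<le> 1"
  shows "(2 * p - 1) * y \<le> ln (step_mgf p y)"
proof -
  have "exp ((1 - p) * (- y) + p * y) \<le> (1 - p) * exp (- y) + p * exp y"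
    using convex_onD[OF exp_convex, of p "- y" y] assms by simp
  then have "exp ((2 * p - 1) * y) \<le> step_mgf p y" by (simp add: step_mgf_def algebra_simps)
  then show ?thesis using step_mgf_pos[OF assms] by (simp add: ln_ge_iff)
qed

text \<open>Tilting by \<open>y\<close>, followed by the uniform bound for the tilted walk at its own rate \<open>s * step_mgf p y\<close>.
  The dependence of that rate on \<open>y\<close> is resolved into terms with computable expectation: the logarithm
  is bounded below linearly, the reciprocal above by \<open>step_mgf p (- y)\<close>.\<close>

lemma minus_ln_pmf_nn_walk_ge:
  assumes p: "0 \<le> p" "p \<le> 1" and s: "0 < s" and pos: "0 < pmf (nn_walk p s) x"
  shows "y * x - s * (step_mgf p y - 1) - 540 / s * step_mgf p (- y) + ln (2 * pi * s) / 2 + (2 * p - 1) * y / 2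
    \<le> - ln (pmf (nn_walk p s) x)"
proof -
  let ?M = "step_mgf p y"
  have M: "0 < ?M" by (rule step_mgf_pos[OF p])
  have sM: "0 < s * ?M" using M s by simp
  have "pmf (nn_walk p s) x * exp (y * x) \<le> exp (s * (?M - 1)) * ((1 + 540 / (s * ?M)) / sqrt (2 * pi * (s * ?M)))"
    unfolding pmf_nn_walk_tilt[OF p s] using tilt_bounds[OF p] sM by (intro mult_left_mono pmf_nn_walk_le) auto
  moreover have e: "0 < 1 + 540 / (s * ?M)" using sM by (simp add: add_pos_pos)
  ultimately have "ln (pmf (nn_walk p s) x * exp (y * x)) \<le> ln (exp (s * (?M - 1)) * ((1 + 540 / (s * ?M)) / sqrt (2 * pi * (s * ?M))))"
    using pos M s by (subst ln_le_cancel_iff) auto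
  also have "ln (pmf (nn_walk p s) x * exp (y * x)) = ln (pmf (nn_walk p s) x) + y * x"
    using pos by (simp add: ln_mult)
  also have "ln (exp (s * (?M - 1)) * ((1 + 540 / (s * ?M)) / sqrt (2 * pi * (s * ?M))))
     = s * (?M - 1) + ln (1 + 540 / (s * ?M)) - (ln (2 * pi * s) + ln ?M) / 2"
    using e M s sM by (simp add: ln_mult ln_div ln_sqrt)
  finally have "ln (pmf (nn_walk p s) x) + y * x \<le> s * (?M - 1) + ln (1 + 540 / (s * ?M)) - (ln (2 * pi * s) + ln ?M) / 2" .
  moreover have "ln (1 + 540 / (s * ?M)) \<le> 540 / s * step_mgf p (- y)"
  proof -
    have "ln (1 + 540 / (s * ?M)) \<le> 540 / (s * ?M)" using sM by (intro ln_add_one_self_le_self) simp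
    also have "\<dots> = 540 / s * (1 / ?M)" by simp
    also have "\<dots> \<le> 540 / s * step_mgf p (- y)" using step_mgf_inverse[OF p] s by (intro mult_left_mono) auto
    finally show ?thesis .
  qed
  moreover have "(2 * p - 1) * y / 2 \<le> ln ?M / 2" using step_mgf_ln_ge[OF p, of y] by simp
  ultimately show ?thesis by (simp add: add_divide_distrib)
qed

text \<open>Exponential moments at the scale of the tilts used below. The exponent is \<open>s\<close> times a convex
  combination of \<open>exp c - 1 - c\<close> and \<open>exp (- c) - 1 + c\<close>, hence close to \<open>s * (1/s)\<^sup>2 / 2\<close>.\<close>

lemma nn_walk_centred_exp_moment:
  assumes p: "0 \<le> p" "p \<le> 1" and s: "1 \<le> s" and c: "c = 1 / s \<or> c = - 1 / s"
  obtains e where "has_bochner_integral (nn_walk p s) (\<lambda>x. exp (c * (of_int x - s * (2 * p - 1)))) e"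
    "e \<le> 1 + 1 / (2 * s) + 3 / (2 * s\<^sup>2)"
proof
  define y where "y = 1 / s"
  have y: "0 \<le> y" "y \<le> 1" "s * y = 1" using s by (auto simp: y_def)
  define b where "b = s * (step_mgf p c - 1) - c * (s * (2 * p - 1))"
  have eq: "exp (c * (of_int x - s * (2 * p - 1))) = exp (c * of_int x) * exp (- (c * (s * (2 * p - 1))))" for x
    by (simp add: algebra_simps flip: exp_add)
  show "has_bochner_integral (nn_walk p s) (\<lambda>x. exp (c * (of_int x - s * (2 * p - 1))))
     (exp (s * (step_mgf p c - 1)) * exp (- (c * (s * (2 * p - 1)))))"
    unfolding eq using p s by (intro has_bochner_integral_mult_left nn_walk_exp_moment) auto
  have bs: "b = s * (step_mgf p c - 1 - c * (2 * p - 1))" by (simp add: b_def algebra_simps)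
  have t: "step_mgf p c - 1 - c * (2 * p - 1) = p * (exp c - 1 - c) + (1 - p) * (exp (- c) - 1 + c)"
    by (simp add: step_mgf_def algebra_simps)
  have "exp c - 1 - c \<le> exp y - 1 - y" "exp (- c) - 1 + c \<le> exp y - 1 - y"
    using c exp_minus_tangent_le[OF y(1)] by (auto simp: y_def)
  then have "step_mgf p c - 1 - c * (2 * p - 1) \<le> p * (exp y - 1 - y) + (1 - p) * (exp y - 1 - y)"
    unfolding t using p by (intro add_mono mult_left_mono) auto
  also have "\<dots> = exp y - 1 - y" by (simp add: algebra_simps)
  also have "\<dots> \<le> y\<^sup>2 / 2 + y ^ 3 / 2" using exp_le_cubic[OF y(1,2)] by simp
  finally have "b \<le> s * (y\<^sup>2 / 2 + y ^ 3 / 2)" unfolding bs using s by (intro mult_left_mono) auto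
  also have "\<dots> = (s * y) * (y / 2 + y\<^sup>2 / 2)" by (simp add: power2_eq_square power3_eq_cube algebra_simps)
  finally have b: "b \<le> y / 2 + y\<^sup>2 / 2" using y by simp
  let ?a = "y / 2 + y\<^sup>2 / 2"
  have y2: "y\<^sup>2 \<le> y" using y by (simp add: power2_eq_square mult_left_le)
  have a: "0 \<le> ?a" "?a \<le> y" using y y2 by auto
  have "exp b \<le> exp ?a" using b by simp
  also have "\<dots> \<le> 1 + ?a + ?a\<^sup>2" using a y by (intro exp_bound) auto
  also have "\<dots> \<le> 1 + ?a + y\<^sup>2" using a by (intro add_left_mono power_mono) auto
  also have "\<dots> = 1 + 1 / (2 * s) + 3 / (2 * s\<^sup>2)" by (simp add: y_def power_divide)
  finally show "exp (s * (step_mgf p c - 1)) * exp (- (c * (s * (2 * p - 1)))) \<le> 1 + 1 / (2 * s) + 3 / (2 * s\<^sup>2)"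
    by (simp add: b_def flip: exp_add)
qed

text \<open>The tilt at the point \<open>x\<close> is \<open>l x = (x - m) / s\<close>, the leading order of the optimal one. The
  expectation of \<open>l x * x\<close> is \<open>1\<close> because the variance is \<open>s\<close>, and the expectation of
  \<open>s * (step_mgf p (l x) - 1)\<close> is \<open>1/2 + O(1/s)\<close>; their difference is the \<open>1/2\<close> in \<open>1/2 * ln (2 * pi * e * s)\<close>.
  The linear correction \<open>(2 * p - 1) * l x / 2\<close> has mean \<open>0\<close>.\<close>

lemma nn_walk_entropy_lower:
  assumes p: "0 \<le> p" "p \<le> 1" and s: "1 \<le> s"
  shows "1/2 * ln (2 * pi * exp 1 * s) - 1622 / s \<le> shannon_entropy (pmf (nn_walk p s))"
proof -
  define \<mu> m where "\<mu> = 2 * p - 1" and "m = s * \<mu>"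
  define l where "l x = (of_int x - m) / s" for x :: int
  have s0: "0 < s" using s by simp
  let ?W = "measure_pmf (nn_walk p s)"
  obtain e1 where e1: "has_bochner_integral ?W (\<lambda>x. exp (l x)) e1" "e1 \<le> 1 + 1 / (2 * s) + 3 / (2 * s\<^sup>2)"
    using nn_walk_centred_exp_moment[OF p s, of "1 / s"] by (auto simp: l_def m_def \<mu>_def)
  obtain e2 where e2: "has_bochner_integral ?W (\<lambda>x. exp (- l x)) e2" "e2 \<le> 1 + 1 / (2 * s) + 3 / (2 * s\<^sup>2)"
    using nn_walk_centred_exp_moment[OF p s, of "- 1 / s"] by (auto simp: l_def m_def \<mu>_def)
  have l: "has_bochner_integral ?W l ((m - m) / s)"
    unfolding l_def m_def \<mu>_def
    by (intro has_bochner_integral_divide has_bochner_integral_diff nn_walk_mean p s0)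
      (simp_all add: has_bochner_integral_iff)
  have lx: "has_bochner_integral ?W (\<lambda>x. l x * of_int x) 1"
  proof -
    have "has_bochner_integral ?W (\<lambda>x. (of_int x - m)\<^sup>2 / s + m * l x) ((s + (s * (2 * p - 1) - m)\<^sup>2) / s + m * ((m - m) / s))"
      by (intro has_bochner_integral_add has_bochner_integral_divide has_bochner_integral_mult_right
        nn_walk_second_moment l p s0)
    moreover have "(of_int x - m)\<^sup>2 / s + m * l x = l x * of_int x" for x
      by (simp add: l_def power2_eq_square algebra_simps flip: add_divide_distrib)
    ultimately show ?thesis using s0 by (simp add: m_def \<mu>_def)
  qed
  have M: "has_bochner_integral ?W (\<lambda>x. step_mgf p (l x)) (p * e1 + (1 - p) * e2)"
    "has_bochner_integral ?W (\<lambda>x. step_mgf p (- l x)) (p * e2 + (1 - p) * e1)"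
    unfolding step_mgf_def minus_minus
    by (intro has_bochner_integral_add has_bochner_integral_mult_right e1 e2)+
  have const: "has_bochner_integral ?W (\<lambda>x. c) c" for c :: real
    by (simp add: has_bochner_integral_iff)
  let ?R = "\<lambda>x. l x * of_int x - s * (step_mgf p (l x) - 1) - 540 / s * step_mgf p (- l x) + ln (2 * pi * s) / 2 + \<mu> * l x / 2"
  let ?r = "1 - s * (p * e1 + (1 - p) * e2 - 1) - 540 / s * (p * e2 + (1 - p) * e1) + ln (2 * pi * s) / 2 + \<mu> * ((m - m) / s) / 2"
  have R: "has_bochner_integral ?W ?R ?r"
    by (intro has_bochner_integral_add has_bochner_integral_diff has_bochner_integral_mult_right
      has_bochner_integral_divide lx M l const)
  have le: "?r \<le> shannon_entropy (pmf (nn_walk p s))"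
    by (rule entropy_ge[OF nn_walk_entropy_upper(1)[OF p s0] R])
      (use minus_ln_pmf_nn_walk_ge[OF p s0] in \<open>simp add: \<mu>_def\<close>)
  let ?E = "1 + 1 / (2 * s) + 3 / (2 * s\<^sup>2)"
  have avg: "p * a + (1 - p) * b \<le> E" if "a \<le> E" "b \<le> E" for a b E :: real
  proof -
    have "p * a + (1 - p) * b \<le> p * E + (1 - p) * E" using that p by (intro add_mono mult_left_mono) auto
    then show ?thesis by (simp add: algebra_simps)
  qed
  have "s * (p * e1 + (1 - p) * e2 - 1) \<le> s * (?E - 1)"
    using avg[OF e1(2) e2(2)] s0 by (intro mult_left_mono) auto
  also have "\<dots> = 1/2 + 3/2 / s" using s0 by (simp add: field_simps power2_eq_square)
  finally have 1: "s * (p * e1 + (1 - p) * e2 - 1) \<le> 1/2 + 3/2 / s" .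
  have "?E \<le> 3"
  proof -
    have "1 / (2 * s) \<le> 1/2" "3 / (2 * s\<^sup>2) \<le> 3/2" using s by (auto simp: divide_le_eq)
    then show ?thesis by simp
  qed
  then have "540 / s * (p * e2 + (1 - p) * e1) \<le> 540 / s * 3"
    using avg[OF e2(2) e1(2)] s0 by (intro mult_left_mono) auto
  with 1 have "1 - (1/2 + 3/2 / s) - 540 / s * 3 + ln (2 * pi * s) / 2 \<le> ?r" by simp
  moreover have "ln (2 * pi * exp 1 * s) = ln (2 * pi * s) + 1" using s0 by (simp add: ln_mult)
  moreover have "1622 / s = 3/2 / s + 540 / s * 3 + 1/2 / s" "0 \<le> 1/2 / s" using s0 by (simp_all add: field_simps)
  ultimately show ?thesis using le by argo
qed

section \<open>The law of the walk\<close>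

lemma measurable_sum_int:
  fixes f :: "nat \<Rightarrow> 'b \<Rightarrow> int"
  assumes "\<And>i. f i \<in> measurable N (count_space UNIV)"
  shows "(\<lambda>x. \<Sum>i<n. f i x) \<in> measurable N (count_space UNIV)"
proof (induction n)
  case (Suc n)
  have "(\<lambda>x. k + f n x) \<in> measurable N (count_space UNIV)" for k
    by (rule measurable_compose[OF assms]) simp
  from measurable_compose_countable[OF this Suc] show ?case by simp
qed simp

definition arrival :: "(nat \<Rightarrow> 'a \<Rightarrow> real) \<Rightarrow> nat \<Rightarrow> 'a \<Rightarrow> real" where
  "arrival \<tau> n \<omega> = (\<Sum>i<n. \<tau> i \<omega>)"

definition jump_sum :: "(nat \<Rightarrow> 'a \<Rightarrow> int) \<Rightarrow> nat \<Rightarrow> 'a \<Rightarrow> int" where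
  "jump_sum \<xi> n \<omega> = (\<Sum>i<n. \<xi> i \<omega>)"

text \<open>Nonnegative holding times make the arrival times monotone, so that the arrivals up to time \<open>s\<close> form
  an initial segment.\<close>

lemma jumps_until_eq:
  assumes "\<And>i. 0 \<le> \<tau> i \<omega>" "arrival \<tau> n \<omega> \<le> s" "s < arrival \<tau> (Suc n) \<omega>"
  shows "jumps_until \<tau> s \<omega> = n"
proof -
  have mono: "arrival \<tau> i \<omega> \<le> arrival \<tau> j \<omega>" if "i \<le> j" for i j
    unfolding arrival_def using that assms(1) by (intro sum_mono2) auto
  have "{k. (\<Sum>i\<le>k. \<tau> i \<omega>) \<le> s} = {..<n}"
  proof (intro set_eqI iffI)
    fix k assume "k \<in> {k. (\<Sum>i\<le>k. \<tau> i \<omega>) \<le> s}"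
    then have "arrival \<tau> (Suc k) \<omega> < arrival \<tau> (Suc n) \<omega>"
      using assms(3) by (simp add: arrival_def lessThan_Suc_atMost del: sum.lessThan_Suc)
    then show "k \<in> {..<n}" using mono[of "Suc n" "Suc k"] by (auto simp: not_le[symmetric])
  next
    fix k assume "k \<in> {..<n}"
    then have "arrival \<tau> (Suc k) \<omega> \<le> s" using mono[of "Suc k" n] assms(2) by simp
    then show "k \<in> {k. (\<Sum>i\<le>k. \<tau> i \<omega>) \<le> s}" by (simp add: arrival_def lessThan_Suc_atMost del: sum.lessThan_Suc)
  qed
  then show ?thesis by (simp add: jumps_until_def)
qed

context rate1_walk
begin

lemma holding_time_measurable [measurable]: "\<tau> i \<in> borel_measurable M"
  using distributed_measurable[OF holding_time[of i]] by simp

lemma increment_measurable [measurable]: "\<xi> i \<in> measurable M (count_space UNIV)"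
proof -
  have "case_sum \<tau> (\<lambda>i \<omega>. real_of_int (\<xi> i \<omega>)) (Inr i) \<in> borel_measurable M"
    using indep unfolding indep_vars_def by blast
  then have [measurable]: "(\<lambda>\<omega>. real_of_int (\<xi> i \<omega>)) \<in> borel_measurable M" by simp
  have "(\<lambda>\<omega>. \<lfloor>real_of_int (\<xi> i \<omega>)\<rfloor>) \<in> measurable M (count_space UNIV)" by measurable
  then show ?thesis by simp
qed

lemma arrival_measurable [measurable]: "arrival \<tau> n \<in> borel_measurable M"
  unfolding arrival_def by measurable

lemma jump_sum_measurable [measurable]: "jump_sum \<xi> n \<in> measurable M (count_space UNIV)"
  unfolding jump_sum_def[abs_def] by (rule measurable_sum_int) measurable

lemma jumps_until_measurable [measurable]: "jumps_until \<tau> s \<in> measurable M (count_space UNIV)"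
  unfolding jumps_until_def by measurable

lemma position_measurable [measurable]: "position \<tau> \<xi> s \<in> measurable M (count_space UNIV)"
proof -
  have "(\<lambda>\<omega>. jump_sum \<xi> (jumps_until \<tau> s \<omega>) \<omega>) \<in> measurable M (count_space UNIV)"
    by (rule measurable_compose_countable) measurable
  then show ?thesis by (simp add: position_def[abs_def] jump_sum_def)
qed

lemma AE_holding_time_nonneg: "AE \<omega> in M. \<forall>i. 0 \<le> \<tau> i \<omega>"
proof (subst AE_all_countable, rule allI)
  fix i
  have "prob {\<omega> \<in> space M. 0 < \<tau> i \<omega>} = 1"
    using exponential_distributedD_gt[OF holding_time[of i]] by simp
  then have "AE \<omega> in M. 0 < \<tau> i \<omega>" by (simp add: AE_in_set_eq_1[symmetric])
  then show "AE \<omega> in M. 0 \<le> \<tau> i \<omega>" by eventually_elim simp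
qed

text \<open>The \<open>n\<close>-th arrival time is a sum of \<open>n\<close> independent exponential variables and has an Erlang law, whose
  distribution function is a Poisson tail.\<close>

lemma prob_arrival_le:
  assumes "0 \<le> s"
  shows "\<P>(\<omega> in M. arrival \<tau> n \<omega> \<le> s) = 1 - (\<Sum>k<n. s ^ k / fact k * exp (- s))"
proof (cases n)
  case 0
  then show ?thesis using assms by (simp add: arrival_def prob_space)
next
  case (Suc m)
  let ?Z = "case_sum \<tau> (\<lambda>i \<omega>. real_of_int (\<xi> i \<omega>))" and ?I = "(Inl :: nat \<Rightarrow> nat + nat) ` {..<n}"
  have "distributed M lborel (\<lambda>\<omega>. \<Sum>i\<in>?I. ?Z i \<omega>) (erlang_density (card ?I - 1) 1)"
    using Suc by (intro exponential_distributed_sum indep_vars_subset[OF indep]) (auto intro: holding_time)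
  then have "distributed M lborel (\<lambda>\<omega>. \<Sum>i<n. \<tau> i \<omega>) (erlang_density m 1)"
    using Suc by (simp add: sum.reindex card_image)
  then have "\<P>(\<omega> in M. (\<Sum>i<n. \<tau> i \<omega>) \<le> s) = erlang_CDF m 1 s"
    using assms Suc by (intro erlang_distributed_le) auto
  then show ?thesis
    using assms Suc by (simp add: arrival_def erlang_CDF_def lessThan_Suc_atMost del: sum.lessThan_Suc)
qed

text \<open>There is no explosion: infinitely many arrivals before \<open>s\<close> would have probability below every
  Poisson tail. In particular the default value \<open>0\<close> of the cardinality in \<^const>\<open>jumps_until\<close> is taken
  only on a null set.\<close>

lemma AE_arrival_exceeds:
  assumes "0 \<le> s"
  shows "AE \<omega> in M. \<exists>n. s < arrival \<tau> n \<omega>"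
proof -
  let ?E = "{\<omega> \<in> space M. \<forall>n. arrival \<tau> n \<omega> \<le> s}"
  have P: "(\<lambda>k. s ^ k / fact k * exp (- s)) sums 1"
    using sums_mult2[OF exp_converges[of s], of "exp (-s)"] by (simp add: field_simps exp_minus)
  have "prob ?E \<le> 1 - (\<Sum>k<n. s ^ k / fact k * exp (- s))" for n
    unfolding prob_arrival_le[OF assms, symmetric] by (intro finite_measure_mono) auto
  moreover have "(\<lambda>n. 1 - (\<Sum>k<n. s ^ k / fact k * exp (- s))) \<longlonglongrightarrow> 1 - 1"
    using P unfolding sums_def by (intro tendsto_diff tendsto_const)
  ultimately have "prob ?E \<le> 0" by (intro LIMSEQ_le_const[of _ "0::real"]) auto
  then have "prob ?E = 0" by (simp add: measure_le_0_iff)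
  then have "AE \<omega> in M. \<not> (\<forall>n. arrival \<tau> n \<omega> \<le> s)"
    by (subst (asm) prob_eq_0) auto
  then show ?thesis by (simp add: not_le)
qed

lemma AE_jumps_until_iff:
  assumes "0 \<le> s"
  shows "AE \<omega> in M. \<forall>n. jumps_until \<tau> s \<omega> = n \<longleftrightarrow> arrival \<tau> n \<omega> \<le> s \<and> s < arrival \<tau> (Suc n) \<omega>"
  using AE_holding_time_nonneg AE_arrival_exceeds[OF assms]
proof eventually_elim
  case (elim \<omega>)
  define m where "m = (LEAST n. s < arrival \<tau> n \<omega>)"
  have m: "s < arrival \<tau> m \<omega>" unfolding m_def using elim(2) by (rule LeastI_ex)
  have "m \<noteq> 0"
  proof
    assume "m = 0"
    then show False using m assms by (simp add: arrival_def)
  qed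
  then obtain k where k: "m = Suc k" by (cases m) auto
  have "arrival \<tau> k \<omega> \<le> s" using not_less_Least[of k "\<lambda>n. s < arrival \<tau> n \<omega>"] k by (simp add: m_def[symmetric])
  then show ?case using jumps_until_eq[of \<tau> \<omega> _ s] elim(1) m k by blast
qed

text \<open>The left event is a function of the holding times alone, the right one of the increments alone.\<close>

lemma prob_arrival_jump_sum:
  "\<P>(\<omega> in M. (arrival \<tau> n \<omega> \<le> s \<and> s < arrival \<tau> (Suc n) \<omega>) \<and> jump_sum \<xi> n \<omega> = x)
   = \<P>(\<omega> in M. arrival \<tau> n \<omega> \<le> s \<and> s < arrival \<tau> (Suc n) \<omega>) * \<P>(\<omega> in M. jump_sum \<xi> n \<omega> = x)"
proof -
  let ?Z = "case_sum \<tau> (\<lambda>i \<omega>. real_of_int (\<xi> i \<omega>))"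
  \<comment> \<open>The event is coded as an integer because \<^const>\<open>indep_var\<close> requires both variables to have the same range type.\<close>
  let ?f = "\<lambda>z::nat + nat \<Rightarrow> real. of_bool ((\<Sum>i<n. z (Inl i)) \<le> s \<and> s < (\<Sum>i<Suc n. z (Inl i))) :: int"
  let ?g = "\<lambda>z::nat + nat \<Rightarrow> real. \<Sum>i<n. \<lfloor>z (Inr i)\<rfloor>"
  have "indep_var (\<Pi>\<^sub>M k\<in>range Inl. borel) (\<lambda>\<omega>. restrict (\<lambda>k. ?Z k \<omega>) (range Inl))
    (\<Pi>\<^sub>M k\<in>range Inr. borel) (\<lambda>\<omega>. restrict (\<lambda>k. ?Z k \<omega>) (range Inr))"
    by (rule indep_var_restrict[OF indep]) auto
  moreover have "?f \<in> measurable (\<Pi>\<^sub>M k\<in>range Inl. borel) (count_space UNIV)"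
    by measurable
  moreover have "?g \<in> measurable (\<Pi>\<^sub>M k\<in>range Inr. borel) (count_space UNIV)"
    by (rule measurable_sum_int) measurable
  ultimately have "indep_var (count_space UNIV) (?f \<circ> (\<lambda>\<omega>. restrict (\<lambda>k. ?Z k \<omega>) (range Inl)))
      (count_space UNIV) (?g \<circ> (\<lambda>\<omega>. restrict (\<lambda>k. ?Z k \<omega>) (range Inr)))"
    by (rule indep_var_compose)
  then have "indep_var (count_space UNIV) (\<lambda>\<omega>. of_bool (arrival \<tau> n \<omega> \<le> s \<and> s < arrival \<tau> (Suc n) \<omega>))
      (count_space UNIV) (jump_sum \<xi> n)"
    by (simp add: comp_def arrival_def[abs_def] jump_sum_def[abs_def] del: sum.lessThan_Suc)
  from indep_varD[OF this, of "{1}" "{x}"] show ?thesis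
    by (simp add: vimage_def Int_def conj_ac)
qed

lemma prob_jump_sum_Suc:
  assumes step: "step = nn_step p" and p: "0 \<le> p" "p \<le> 1"
  shows "\<P>(\<omega> in M. jump_sum \<xi> (Suc n) \<omega> = x)
    = p * \<P>(\<omega> in M. jump_sum \<xi> n \<omega> = x - 1) + (1 - p) * \<P>(\<omega> in M. jump_sum \<xi> n \<omega> = x + 1)"
proof -
  let ?Z = "case_sum \<tau> (\<lambda>i \<omega>. real_of_int (\<xi> i \<omega>))"
  let ?A = "(Inr :: nat \<Rightarrow> nat + nat) ` {..<n}" and ?B = "{Inr n} :: (nat + nat) set"
  let ?g = "\<lambda>z::nat + nat \<Rightarrow> real. \<Sum>i<n. if i < n then \<lfloor>z (Inr i)\<rfloor> else 0"
  have "indep_var (\<Pi>\<^sub>M k\<in>?A. borel) (\<lambda>\<omega>. restrict (\<lambda>k. ?Z k \<omega>) ?A)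
    (\<Pi>\<^sub>M k\<in>?B. borel) (\<lambda>\<omega>. restrict (\<lambda>k. ?Z k \<omega>) ?B)"
    by (rule indep_var_restrict[OF indep]) auto
  \<comment> \<open>The guard \<open>i < n\<close> inside \<open>?g\<close> makes every summand measurable with respect to the coordinates in \<open>?A\<close>.\<close>
  moreover have "?g \<in> measurable (\<Pi>\<^sub>M k\<in>?A. borel) (count_space UNIV)"
  proof (rule measurable_sum_int)
    fix i
    show "(\<lambda>z::nat + nat \<Rightarrow> real. if i < n then \<lfloor>z (Inr i)\<rfloor> else 0) \<in> measurable (\<Pi>\<^sub>M k\<in>?A. borel) (count_space UNIV)"
    proof (cases "i < n")
      case True
      then have "(\<lambda>z::nat + nat \<Rightarrow> real. z (Inr i)) \<in> borel_measurable (\<Pi>\<^sub>M k\<in>?A. borel)"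
        by (intro measurable_component_singleton) simp
      from measurable_compose[OF this measurable_real_floor] show ?thesis by (simp only: True if_True)
    qed simp
  qed
  moreover have "(\<lambda>z::nat + nat \<Rightarrow> real. \<lfloor>z (Inr n)\<rfloor>) \<in> measurable (\<Pi>\<^sub>M k\<in>?B. borel) (count_space UNIV)"
    by measurable
  ultimately have "indep_var (count_space UNIV) (?g \<circ> (\<lambda>\<omega>. restrict (\<lambda>k. ?Z k \<omega>) ?A))
      (count_space UNIV) ((\<lambda>z. \<lfloor>z (Inr n)\<rfloor>) \<circ> (\<lambda>\<omega>. restrict (\<lambda>k. ?Z k \<omega>) ?B))"
    by (rule indep_var_compose)
  then have ind: "indep_var (count_space UNIV) (jump_sum \<xi> n) (count_space UNIV) (\<xi> n)"
    by (simp add: comp_def jump_sum_def[abs_def])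
  have \<xi>: "\<P>(\<omega> in M. \<xi> n \<omega> \<in> Y) = measure_pmf.prob step Y" for Y
    unfolding increment[of n, symmetric] by (subst measure_distr) (auto simp: vimage_def Int_def conj_commute)
  have prod: "\<P>(\<omega> in M. jump_sum \<xi> n \<omega> = z \<and> \<xi> n \<omega> = y) = \<P>(\<omega> in M. jump_sum \<xi> n \<omega> = z) * pmf step y" for y z
    using indep_varD[OF ind, of "{z}" "{y}"] \<xi>[of "{y}"]
    by (simp add: vimage_def Int_def conj_ac measure_pmf_single)
  have pmf1: "pmf step 1 = p"
    using pmf_map_inj'[of "\<lambda>b. if b then 1 else - 1::int" "bernoulli_pmf p" True] p by (simp add: step nn_step_def inj_def)
  have pmf2: "pmf step (- 1) = 1 - p"
    using pmf_map_inj'[of "\<lambda>b. if b then 1 else - 1::int" "bernoulli_pmf p" False] p by (simp add: step nn_step_def inj_def)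
  have "measure_pmf.prob step {1, - 1} = 1"
    using pmf1 pmf2 by (subst measure_measure_pmf_finite) auto
  then have "\<P>(\<omega> in M. \<xi> n \<omega> \<in> {1, - 1}) = 1" unfolding \<xi> .
  then have "AE \<omega> in M. \<xi> n \<omega> \<in> {1, - 1}" by (subst (asm) prob_Collect_eq_1) auto
  moreover have Suc: "jump_sum \<xi> (Suc n) \<omega> = jump_sum \<xi> n \<omega> + \<xi> n \<omega>" for \<omega>
    by (simp add: jump_sum_def)
  ultimately have "\<P>(\<omega> in M. jump_sum \<xi> (Suc n) \<omega> = x)
    = prob ({\<omega> \<in> space M. jump_sum \<xi> n \<omega> = x - 1 \<and> \<xi> n \<omega> = 1} \<union> {\<omega> \<in> space M. jump_sum \<xi> n \<omega> = x + 1 \<and> \<xi> n \<omega> = - 1})"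
    by (intro measure_eq_AE) (auto simp: Suc elim!: eventually_mono)
  also have "\<dots> = p * \<P>(\<omega> in M. jump_sum \<xi> n \<omega> = x - 1) + (1 - p) * \<P>(\<omega> in M. jump_sum \<xi> n \<omega> = x + 1)"
    by (subst finite_measure_Union) (auto simp: prod pmf1 pmf2)
  finally show ?thesis .
qed

lemma prob_jump_sum:
  assumes "step = nn_step p" "0 \<le> p" "p \<le> 1"
  shows "\<P>(\<omega> in M. jump_sum \<xi> n \<omega> = x) = pmf (nn_sum p n) x"
proof (induction n arbitrary: x)
  case 0
  then show ?case by (auto simp: jump_sum_def prob_space split: split_indicator)
next
  case (Suc n)
  then show ?case by (simp add: prob_jump_sum_Suc[OF assms] pmf_nn_sum_Suc[OF assms(2,3)])
qed

lemma prob_arrival_between: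
  assumes "0 \<le> s"
  shows "\<P>(\<omega> in M. arrival \<tau> n \<omega> \<le> s \<and> s < arrival \<tau> (Suc n) \<omega>) = s ^ n / fact n * exp (- s)"
proof -
  have "\<P>(\<omega> in M. arrival \<tau> n \<omega> \<le> s \<and> s < arrival \<tau> (Suc n) \<omega>)
    = prob ({\<omega> \<in> space M. arrival \<tau> n \<omega> \<le> s} - {\<omega> \<in> space M. arrival \<tau> n \<omega> \<le> s \<and> arrival \<tau> (Suc n) \<omega> \<le> s})"
    by (rule arg_cong[where f=prob]) auto
  also have "\<dots> = \<P>(\<omega> in M. arrival \<tau> n \<omega> \<le> s) - \<P>(\<omega> in M. arrival \<tau> n \<omega> \<le> s \<and> arrival \<tau> (Suc n) \<omega> \<le> s)"
    by (rule finite_measure_Diff) auto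
  also have "\<P>(\<omega> in M. arrival \<tau> n \<omega> \<le> s \<and> arrival \<tau> (Suc n) \<omega> \<le> s) = \<P>(\<omega> in M. arrival \<tau> (Suc n) \<omega> \<le> s)"
  proof (rule measure_eq_AE)
    show "AE \<omega> in M. \<omega> \<in> {\<omega> \<in> space M. arrival \<tau> n \<omega> \<le> s \<and> arrival \<tau> (Suc n) \<omega> \<le> s}
      \<longleftrightarrow> \<omega> \<in> {\<omega> \<in> space M. arrival \<tau> (Suc n) \<omega> \<le> s}"
      using AE_holding_time_nonneg
    proof eventually_elim
      case (elim \<omega>)
      then have "arrival \<tau> n \<omega> \<le> arrival \<tau> (Suc n) \<omega>" by (simp add: arrival_def)
      then show ?case by auto
    qed
  qed auto
  finally show ?thesis by (simp add: prob_arrival_le[OF assms])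
qed

text \<open>Decomposition according to the number of jumps, which is Poisson distributed and independent of the
  increments.\<close>

lemma walk_law_eq:
  assumes step: "step = nn_step p" "0 \<le> p" "p \<le> 1" and s: "0 < s"
  shows "walk_law M \<tau> \<xi> s = pmf (nn_walk p s)"
proof
  fix x
  let ?E = "\<lambda>n. {\<omega> \<in> space M. jumps_until \<tau> s \<omega> = n \<and> jump_sum \<xi> n \<omega> = x}"
  have "(\<lambda>n. prob (?E n)) sums prob (\<Union>n. ?E n)"
    by (rule finite_measure_UNION) (auto simp: disjoint_family_on_def)
  also have "(\<Union>n. ?E n) = {\<omega> \<in> space M. position \<tau> \<xi> s \<omega> = x}"
    by (auto simp: position_def jump_sum_def)
  also have "(\<lambda>n. prob (?E n)) = (\<lambda>n. s ^ n / fact n * exp (- s) * pmf (nn_sum p n) x)"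
  proof
    fix n
    have "prob (?E n) = \<P>(\<omega> in M. (arrival \<tau> n \<omega> \<le> s \<and> s < arrival \<tau> (Suc n) \<omega>) \<and> jump_sum \<xi> n \<omega> = x)"
      by (rule measure_eq_AE) (use AE_jumps_until_iff[of s] s in \<open>auto elim!: eventually_mono\<close>)
    then show "prob (?E n) = s ^ n / fact n * exp (- s) * pmf (nn_sum p n) x"
      using s unfolding prob_arrival_jump_sum by (simp add: prob_arrival_between prob_jump_sum[OF step])
  qed
  finally have "(\<lambda>n. s ^ n / fact n * exp (- s) * pmf (nn_sum p n) x) sums walk_law M \<tau> \<xi> s x"
    by (simp add: walk_law_def)
  with nn_walk_sums[OF s] show "walk_law M \<tau> \<xi> s x = pmf (nn_walk p s) x"
    by (rule sums_unique2[rotated])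
qed

end

section \<open>The entropy asymptotics\<close>

theorem propositionA9:
  fixes step :: "int pmf" and \<sigma> :: real
  assumes "step = simple_step \<or> step = directed_step" and "\<sigma> > 0"
  shows "\<exists>C. \<forall>(M :: 'a measure) \<tau> \<xi>. rate1_walk M step \<tau> \<xi> \<longrightarrow>
           (\<forall>s\<ge>\<sigma>. entropy_summand (walk_law M \<tau> \<xi> s) summable_on UNIV \<and>
              \<bar>shannon_entropy (walk_law M \<tau> \<xi> s) - 1/2 * ln (2 * pi * exp 1 * s)\<bar> \<le> C * s powr (- 1/4))"
proof -
  obtain p :: real where p: "step = nn_step p" "0 \<le> p" "p \<le> 1"
  proof (cases "step = simple_step")
    case True
    then show ?thesis using that[of "1/2"] simple_step_eq by simp
  next
    case False
    then show ?thesis using that[of 1] assms(1) directed_step_eq by simp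
  qed
  define c where "c = 1/2 * ln (2 * pi * exp 1)"
  define C where "C = 1622 + 1 / \<sigma> + c"
  \<comment> \<open>For \<open>s < 1\<close> the power \<open>s powr (- 1/4)\<close> is at least \<open>1\<close>, so that bounding both sides by constants suffices;
     \<open>c\<close> is the value of the main term at \<open>s = 1\<close>.\<close>
  have "1 * 1 \<le> 2 * pi * exp (1::real)" using pi_ge_two by (intro mult_mono) auto
  then have c0: "0 \<le> c" by (simp add: c_def)
  have \<sigma>0: "0 < 1 / \<sigma>" using assms(2) by simp
  have bound: "\<bar>shannon_entropy (pmf (nn_walk p s)) - 1/2 * ln (2 * pi * exp 1 * s)\<bar> \<le> C * s powr (- 1/4)"
    if "\<sigma> \<le> s" for s
  proof -
    define H G where "H = shannon_entropy (pmf (nn_walk p s))" and "G = 1/2 * ln (2 * pi * exp 1 * s)"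
    have s: "0 < s" using that assms(2) by simp
    note up = nn_walk_entropy_upper[OF p(2,3) s, folded H_def G_def]
    show ?thesis
    proof (cases "1 \<le> s")
      case True
      have "s powr (- 1) \<le> s powr (- 1/4)" using True by (intro powr_mono) auto
      then have s4: "1 / s \<le> s powr (- 1/4)" using s by (simp add: powr_minus_divide)
      have "G - 1622 / s \<le> H" using nn_walk_entropy_lower[OF p(2,3) True] by (simp add: H_def G_def)
      moreover have "1 / (24 * s) \<le> 1622 * (1 / s)" using s by (simp add: field_simps)
      ultimately have "\<bar>H - G\<bar> \<le> 1622 * (1 / s)" using up(3) by (simp add: abs_le_iff)
      also have "\<dots> \<le> C * s powr (- 1/4)"
        using s4 c0 \<sigma>0 s by (intro mult_mono) (auto simp: C_def)
      finally show ?thesis by (simp add: H_def G_def)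
    next
      case False
      have s4: "1 \<le> s powr (- 1/4)" using s False powr_mono'[of "- 1/4" 0 s] by simp
      have "G = c + ln s / 2" using s by (simp add: G_def c_def ln_mult)
      then have "G \<le> c" using s False by simp
      then have "G - H \<le> C" using up(2) \<sigma>0 unfolding C_def by linarith
      moreover have "H - G \<le> C"
      proof -
        have "1 / (24 * s) \<le> 1 / \<sigma>" using that assms(2) by (intro divide_left_mono) auto
        then show ?thesis using up(3) c0 by (simp add: C_def)
      qed
      ultimately have "\<bar>H - G\<bar> \<le> C * 1" by (simp add: abs_le_iff)
      also have "\<dots> \<le> C * s powr (- 1/4)"
        using s4 c0 \<sigma>0 by (intro mult_left_mono) (auto simp: C_def)
      finally show ?thesis by (simp add: H_def G_def)
    qed
  qed
  show ?thesis
  proof (intro exI[of _ C] allI impI)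
    fix M :: "'a measure" and \<tau> \<xi> s
    assume "rate1_walk M step \<tau> \<xi>" and s: "\<sigma> \<le> s"
    then interpret rate1_walk M step \<tau> \<xi> by simp
    have s0: "0 < s" using s assms(2) by simp
    show "entropy_summand (walk_law M \<tau> \<xi> s) summable_on UNIV \<and>
              \<bar>shannon_entropy (walk_law M \<tau> \<xi> s) - 1/2 * ln (2 * pi * exp 1 * s)\<bar> \<le> C * s powr (- 1/4)"
      unfolding walk_law_eq[OF p s0] using bound[OF s] nn_walk_entropy_upper(1)[OF p(2,3) s0] by simp
  qed
qed

end
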